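(* Let $\mathcal{A}\otimes\mathcal{C}$, $\epsilon$, the elements $O_A$, $O_{A_1,\dots,A_r}$ and the supercommutator $\llbracket\cdot,\cdot\rrbracket_-$ be as defined in the context. Let $A$ be a list of distinct elements of $\{1,\dots,N\}$. Then $$\sum_{a\in A}\llbracket O_a,O_{a,A}\rrbracket_-=0 .$$
   Context: Let $\mathbb{K}$ be $\mathbb{R}$ or $\mathbb{C}$ and $N\ge1$. $\mathcal{A}$ is the unital associative $\mathbb{K}$-algebra generated by $x_1,\dots,x_N,p_1,\dots,p_N$ subject to the relations, for all $i,j$, $$[x_i,x_j]=0,\quad [p_i,p_j]=0,\quad \Big[\tfrac12\sum_{i=1}^N p_i^2,\,x_j\Big]=p_j,\quad \Big[\tfrac12\sum_{i=1}^N x_i^2,\,p_j\Big]=-x_j,$$ where $[a,b]=ab-ba$. Fix $\epsilon\in\{+1,-1\}$. $\mathcal{C}$ is the Clifford algebra over $\mathbb{K}$ generated by $e_1,\dots,e_N$ with $e_ie_j+e_je_i=2\epsilon\delta_{ij}$. In $\mathcal{A}\otimes\mathcal{C}$ the tensor sign is omitted, and the $e_i$ commute with all $x_j,p_j$. Put $\underline{D}=\sum_{i=1}^N e_ip_i$. A list is a finite (possibly empty) sequence $A=a_1\cdots a_n$ of distinct elements of $\{1,\dots,N\}$, $|A|=n$; $e_A=e_{a_1}\cdots e_{a_n}$, $e_\emptyset=1$. In set operations a list is viewed as its underlying set; $A\triangle B=(A\cup B)\setminus(A\cap B)$ is the symmetric difference. For a set (or list) $S\subset\{1,\dots,N\}$,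 $\underline{x}_S=\sum_{s\in S}x_se_s$. For lists $A_1,\dots,A_r$ ($r\ge1$), with $S=A_1\triangle\cdots\triangle A_r$ and $E=e_{A_1}\cdots e_{A_r}$, define $$O_{A_1,\dots,A_r}=\tfrac12\big(\underline{D}\,\underline{x}_S E-E\,\underline{x}_S\underline{D}-\epsilon E\big);$$ in particular $O_A$ is the case $r=1$, and $O_a$ is the case of the one-element list $a$. The set $S$ is called the index set of $O_{A_1,\dots,A_r}$. For two such operators $X,Y$ with index sets $S,T$, the supercommutators are $$\llbracket X,Y\rrbracket_\mp=XY\mp(-1)^{|S||T|-|S\cap T|}YX .$$ *)

theory Defs
  imports Complex_Main "HOL-Library.Poly_Mapping" "HOL-Algebra.QuotRing" "HOL-Algebra.Module"
begin

section \<open>Unital associative algebras over a field\<close>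

text \<open>A \<open>\<bbbK>\<close>-algebra is represented by a record of type \<^typ>\<open>('k, 'a) module\<close>, which carries
  both the ring operations and the scalar multiplication \<open>\<odot>\<close>.  The locale \<^locale>\<open>algebra\<close> of
  the library is not used, since it is restricted to commutative rings.\<close>

definition monoid_algebra ::
    "('m, 'r) monoid_scheme \<Rightarrow> ('k::field, 'm \<Rightarrow>\<^sub>0 'k) module" where
  "monoid_algebra G =
     \<lparr>carrier = {f. Poly_Mapping.keys f \<subseteq> carrier G},
      mult = (\<lambda>f g. \<Sum>u\<in>Poly_Mapping.keys f. \<Sum>v\<in>Poly_Mapping.keys g.
                Poly_Mapping.single (u \<otimes>\<^bsub>G\<^esub> v) (Poly_Mapping.lookup f u * Poly_Mapping.lookup g v)),
      one = Poly_Mapping.single \<one>\<^bsub>G\<^esub> 1,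
      zero = 0,
      add = (+),
      smult = (\<lambda>c. Poly_Mapping.map ((*) c))\<rparr>"

definition free_monoid :: "'g set \<Rightarrow> 'g list monoid" where
  "free_monoid S = \<lparr>carrier = lists S, mult = (@), one = []\<rparr>"

definition free_algebra :: "'g set \<Rightarrow> ('k::field, 'g list \<Rightarrow>\<^sub>0 'k) module" where
  "free_algebra S = monoid_algebra (free_monoid S)"

definition free_gen :: "'g \<Rightarrow> 'g list \<Rightarrow>\<^sub>0 'k::field" where
  "free_gen g = Poly_Mapping.single [g] 1"

text \<open>The quotient by a two-sided ideal \<open>I\<close>: the library's quotient ring, with the scalar
  multiplication \<open>c (a + I) = c a + I\<close>, written without representatives
  in the same way as the library's product \<^const>\<open>rcoset_mult\<close> of cosets.\<close>

definition quotient_algebra ::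
    "('k, 'a) module \<Rightarrow> 'a set \<Rightarrow> ('k, 'a set) module" where
  "quotient_algebra M I =
     ring.extend (M Quot I)
       (module.fields (\<lambda>c U. \<Union>a\<in>U. I +>\<^bsub>M\<^esub> (c \<odot>\<^bsub>M\<^esub> a)))"

definition presented_algebra ::
    "'g set \<Rightarrow> ('g list \<Rightarrow>\<^sub>0 'k) set \<Rightarrow> ('k::field, ('g list \<Rightarrow>\<^sub>0 'k) set) module" where
  "presented_algebra S R =
     quotient_algebra (free_algebra S) (Idl\<^bsub>free_algebra S\<^esub> R)"

definition presented_gen ::
    "'g set \<Rightarrow> ('g list \<Rightarrow>\<^sub>0 'k) set \<Rightarrow> 'g \<Rightarrow> ('g list \<Rightarrow>\<^sub>0 'k::field) set" where
  "presented_gen S R g =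
     (Idl\<^bsub>free_algebra S\<^esub> R) +>\<^bsub>free_algebra S\<^esub> free_gen g"

definition commutator :: "('a, 'r) ring_scheme \<Rightarrow> 'a \<Rightarrow> 'a \<Rightarrow> 'a" where
  "commutator R a b = a \<otimes>\<^bsub>R\<^esub> b \<ominus>\<^bsub>R\<^esub> b \<otimes>\<^bsub>R\<^esub> a"


section \<open>Tensor product of algebras\<close>

text \<open>The free vector space on \<open>M \<times> M'\<close> with the product \<open>(a, b) (a', b') = (a a', b b')\<close> of basis
  elements is the monoid algebra of the product of the multiplicative monoids.  A product of a
  bilinearity relator with a basis element is again a bilinearity relator, so the ideal generated
  by these relators is their linear span, and the quotient has the tensor product of the
  vector spaces as its underlying vector space.\<close>

definition bilinearity_relators ::
    "('k, 'a) module \<Rightarrow> ('k, 'b) module \<Rightarrow> ('a \<times> 'b \<Rightarrow>\<^sub>0 'k::field) set" where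
  "bilinearity_relators M M' =
     {Poly_Mapping.single (a \<oplus>\<^bsub>M\<^esub> a', b) 1
        - Poly_Mapping.single (a, b) 1 - Poly_Mapping.single (a', b) 1 | a a' b.
        a \<in> carrier M \<and> a' \<in> carrier M \<and> b \<in> carrier M'} \<union>
     {Poly_Mapping.single (a, b \<oplus>\<^bsub>M'\<^esub> b') 1
        - Poly_Mapping.single (a, b) 1 - Poly_Mapping.single (a, b') 1 | a b b'.
        a \<in> carrier M \<and> b \<in> carrier M' \<and> b' \<in> carrier M'} \<union>
     {Poly_Mapping.single (c \<odot>\<^bsub>M\<^esub> a, b) 1 - Poly_Mapping.single (a, b) c | c a b.
        a \<in> carrier M \<and> b \<in> carrier M'} \<union>
     {Poly_Mapping.single (a, c \<odot>\<^bsub>M'\<^esub> b) 1 - Poly_Mapping.single (a, b) c | c a b.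
        a \<in> carrier M \<and> b \<in> carrier M'}"

definition tensor_ideal ::
    "('k, 'a) module \<Rightarrow> ('k, 'b) module \<Rightarrow> ('a \<times> 'b \<Rightarrow>\<^sub>0 'k::field) set" where
  "tensor_ideal M M' =
     Idl\<^bsub>monoid_algebra (M \<times>\<times> M')\<^esub> (bilinearity_relators M M')"

definition tensor_algebra ::
    "('k, 'a) module \<Rightarrow> ('k, 'b) module \<Rightarrow> ('k::field, ('a \<times> 'b \<Rightarrow>\<^sub>0 'k) set) module" where
  "tensor_algebra M M' = quotient_algebra (monoid_algebra (M \<times>\<times> M')) (tensor_ideal M M')"

definition pure_tensor ::
    "('k, 'a) module \<Rightarrow> ('k, 'b) module \<Rightarrow> 'a \<Rightarrow> 'b \<Rightarrow> ('a \<times> 'b \<Rightarrow>\<^sub>0 'k::field) set" where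
  "pure_tensor M M' a b =
     tensor_ideal M M' +>\<^bsub>monoid_algebra (M \<times>\<times> M')\<^esub> Poly_Mapping.single (a, b) 1"


section \<open>The algebras \<open>\<A>\<close>, \<open>\<C>\<close> and \<open>\<A> \<otimes> \<C>\<close>\<close>

datatype xp = X nat | P nat

type_synonym 'k \<A> = "(xp list \<Rightarrow>\<^sub>0 'k) set"
type_synonym 'k \<C> = "(nat list \<Rightarrow>\<^sub>0 'k) set"
type_synonym 'k \<A>\<C> = "('k \<A> \<times> 'k \<C> \<Rightarrow>\<^sub>0 'k) set"

definition xp_gens :: "nat \<Rightarrow> xp set" where
  "xp_gens N = X ` {1..N} \<union> P ` {1..N}"

definition xp_relators :: "nat \<Rightarrow> (xp list \<Rightarrow>\<^sub>0 'k::field) set" where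
  "xp_relators N =
     (let F = free_algebra (xp_gens N);
          x = (\<lambda>i. free_gen (X i));
          p = (\<lambda>i. free_gen (P i));
          half_p2 = (1/2) \<odot>\<^bsub>F\<^esub> (\<Oplus>\<^bsub>F\<^esub>i\<in>{1..N}. p i \<otimes>\<^bsub>F\<^esub> p i);
          half_x2 = (1/2) \<odot>\<^bsub>F\<^esub> (\<Oplus>\<^bsub>F\<^esub>i\<in>{1..N}. x i \<otimes>\<^bsub>F\<^esub> x i)
      in {commutator F (x i) (x j) | i j. i \<in> {1..N} \<and> j \<in> {1..N}} \<union>
         {commutator F (p i) (p j) | i j. i \<in> {1..N} \<and> j \<in> {1..N}} \<union>
         {commutator F half_p2 (x j) \<ominus>\<^bsub>F\<^esub> p j | j. j \<in> {1..N}} \<union>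
         {commutator F half_x2 (p j) \<oplus>\<^bsub>F\<^esub> x j | j. j \<in> {1..N}})"

definition \<A> :: "nat \<Rightarrow> ('k::field, 'k \<A>) module" where
  "\<A> N = presented_algebra (xp_gens N) (xp_relators N)"

definition clifford_relators :: "nat \<Rightarrow> int \<Rightarrow> (nat list \<Rightarrow>\<^sub>0 'k::field) set" where
  "clifford_relators N \<epsilon> =
     (let F = free_algebra {1..N};
          e = free_gen
      in {(e i \<otimes>\<^bsub>F\<^esub> e j \<oplus>\<^bsub>F\<^esub> e j \<otimes>\<^bsub>F\<^esub> e i)
            \<ominus>\<^bsub>F\<^esub> (if i = j then 2 * of_int \<epsilon> else 0) \<odot>\<^bsub>F\<^esub> \<one>\<^bsub>F\<^esub>
          | i j. i \<in> {1..N} \<and> j \<in> {1..N}})"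

definition \<C> :: "nat \<Rightarrow> int \<Rightarrow> ('k::field, 'k \<C>) module" where
  "\<C> N \<epsilon> = presented_algebra {1..N} (clifford_relators N \<epsilon>)"

text \<open>The argument \<open>K\<close> only serves to name the ground field, as in \<open>\<A>\<C> TYPE(real) N \<epsilon>\<close>.\<close>

definition \<A>\<C> :: "'k itself \<Rightarrow> nat \<Rightarrow> int \<Rightarrow> ('k::field, 'k \<A>\<C>) module" where
  "\<A>\<C> K N \<epsilon> = tensor_algebra (\<A> N) (\<C> N \<epsilon>)"

definition x_elem :: "nat \<Rightarrow> int \<Rightarrow> nat \<Rightarrow> 'k::field \<A>\<C>" where
  "x_elem N \<epsilon> i = pure_tensor (\<A> N) (\<C> N \<epsilon>)
     (presented_gen (xp_gens N) (xp_relators N) (X i)) \<one>\<^bsub>\<C> N \<epsilon>\<^esub>"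

definition p_elem :: "nat \<Rightarrow> int \<Rightarrow> nat \<Rightarrow> 'k::field \<A>\<C>" where
  "p_elem N \<epsilon> i = pure_tensor (\<A> N) (\<C> N \<epsilon>)
     (presented_gen (xp_gens N) (xp_relators N) (P i)) \<one>\<^bsub>\<C> N \<epsilon>\<^esub>"

definition e_elem :: "nat \<Rightarrow> int \<Rightarrow> nat \<Rightarrow> 'k::field \<A>\<C>" where
  "e_elem N \<epsilon> i = pure_tensor (\<A> N) (\<C> N \<epsilon>)
     \<one>\<^bsub>\<A> N\<^esub> (presented_gen {1..N} (clifford_relators N \<epsilon>) i)"


section \<open>The operators \<open>O\<close> and the supercommutator\<close>

definition D_elem :: "nat \<Rightarrow> int \<Rightarrow> 'k::field \<A>\<C>" where
  "D_elem N \<epsilon> =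
     (\<Oplus>\<^bsub>\<A>\<C> TYPE('k) N \<epsilon>\<^esub>i\<in>{1..N}. e_elem N \<epsilon> i \<otimes>\<^bsub>\<A>\<C> TYPE('k) N \<epsilon>\<^esub> p_elem N \<epsilon> i)"

definition x_vec :: "nat \<Rightarrow> int \<Rightarrow> nat set \<Rightarrow> 'k::field \<A>\<C>" where
  "x_vec N \<epsilon> S =
     (\<Oplus>\<^bsub>\<A>\<C> TYPE('k) N \<epsilon>\<^esub>s\<in>S. x_elem N \<epsilon> s \<otimes>\<^bsub>\<A>\<C> TYPE('k) N \<epsilon>\<^esub> e_elem N \<epsilon> s)"

definition e_list :: "nat \<Rightarrow> int \<Rightarrow> nat list \<Rightarrow> 'k::field \<A>\<C>" where
  "e_list N \<epsilon> A =
     foldr (\<lambda>a z. e_elem N \<epsilon> a \<otimes>\<^bsub>\<A>\<C> TYPE('k) N \<epsilon>\<^esub> z) A \<one>\<^bsub>\<A>\<C> TYPE('k) N \<epsilon>\<^esub>"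

definition e_lists :: "nat \<Rightarrow> int \<Rightarrow> nat list list \<Rightarrow> 'k::field \<A>\<C>" where
  "e_lists N \<epsilon> As =
     foldr (\<lambda>A z. e_list N \<epsilon> A \<otimes>\<^bsub>\<A>\<C> TYPE('k) N \<epsilon>\<^esub> z) As \<one>\<^bsub>\<A>\<C> TYPE('k) N \<epsilon>\<^esub>"

definition index_set :: "nat list list \<Rightarrow> nat set" where
  "index_set As = foldr (\<lambda>A S. sym_diff (set A) S) As {}"

text \<open>\<open>O_op N \<epsilon> [A\<^sub>1, \<dots>, A\<^sub>r]\<close> is the operator with subscripts \<open>A\<^sub>1, \<dots>, A\<^sub>r\<close>, so \<open>O_op N \<epsilon> [[a]]\<close> is
  the operator of the one-element list \<open>a\<close>.\<close>

definition O_op :: "nat \<Rightarrow> int \<Rightarrow> nat list list \<Rightarrow> 'k::field \<A>\<C>" where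
  "O_op N \<epsilon> As =
     (let T = \<A>\<C> TYPE('k) N \<epsilon>;
          D = D_elem N \<epsilon>;
          xS = x_vec N \<epsilon> (index_set As);
          E = e_lists N \<epsilon> As
      in (1/2) \<odot>\<^bsub>T\<^esub> (D \<otimes>\<^bsub>T\<^esub> xS \<otimes>\<^bsub>T\<^esub> E \<ominus>\<^bsub>T\<^esub> E \<otimes>\<^bsub>T\<^esub> xS \<otimes>\<^bsub>T\<^esub> D \<ominus>\<^bsub>T\<^esub> of_int \<epsilon> \<odot>\<^bsub>T\<^esub> E))"

text \<open>The sign of the supercommutator depends on the index sets, which belong to the subscripts
  and not to the elements they denote; hence it takes the subscripts as arguments.  The natural
  number subtraction in the exponent does not truncate, as \<open>|U \<inter> V| \<le> |U| |V|\<close> for finite sets.\<close>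

definition supercommutator :: "nat \<Rightarrow> int \<Rightarrow> nat list list \<Rightarrow> nat list list \<Rightarrow> 'k::field \<A>\<C>" where
  "supercommutator N \<epsilon> As Bs =
     (let T = \<A>\<C> TYPE('k) N \<epsilon>;
          U = index_set As;
          V = index_set Bs
      in O_op N \<epsilon> As \<otimes>\<^bsub>T\<^esub> O_op N \<epsilon> Bs
         \<ominus>\<^bsub>T\<^esub> (-1) ^ (card U * card V - card (U \<inter> V)) \<odot>\<^bsub>T\<^esub> (O_op N \<epsilon> Bs \<otimes>\<^bsub>T\<^esub> O_op N \<epsilon> As))"

end

(* Put Q a = [D, x a] - e a, which is 2 \<epsilon> O_a.  Then Q a = \<Sum>i. e i * q a i, where
   q a i = [p i, x a] - \<delta>_{ai} is symmetric by the Jacobi identity and commutes with the Clifford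
   generators.  Moreover Q a anticommutes with D, and [Q a, x b] is symmetric in a and b.  Moving D
   out of the sum of supercommutators leaves three sums over pairs or triples of indices in A; the
   indices outside A cancel by the sign of the supercommutator, and each remaining summand is the
   product of a symmetric factor and an antisymmetric Clifford factor. *)
theory Submission
  imports Defs
begin

text \<open>The relations determine no value for the commutator [p i, x a], so only its symmetry is
  available, and every sum has to be brought to a form in which a symmetric factor meets an
  antisymmetric one. The sign makes this possible. The index sets {a} and A - {a} of the two
  operators are disjoint, so the supercommutator carries the sign (-1) to the power |A| - 1. This is
  exactly the sign with which e_A passes e_i for i in A; for i outside A the sign is the opposite
  one. Outside A the defect is made up by moving e_i past e_a alone (one change of sign) or past e_b
  e_a (none), which is why a difference vanishes there in the first case and a sum in the second.
  Since the generators live in iterated quotients, the relations are obtained by pulling one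
  representation of the tensor product back to the free algebras, where a relator is an explicit
  expression in words and is sent to zero.\<close>

section \<open>The computation in a ring\<close>

text \<open>The diagonal is a separate hypothesis because \<open>f a a = - f a a\<close> does not
  force zero in a group that may have 2-torsion. In the induction the row and the column of the new
  index cancel.\<close>

lemma sum_antisym_eq_0:
  fixes f :: "'i \<Rightarrow> 'i \<Rightarrow> 'a::ab_group_add"
  assumes "finite S"
    and "\<And>a. a \<in> S \<Longrightarrow> f a a = 0"
    and "\<And>a b. \<lbrakk>a \<in> S; b \<in> S; a \<noteq> b\<rbrakk> \<Longrightarrow> f a b = - f b a"
  shows "(\<Sum>a\<in>S. \<Sum>b\<in>S. f a b) = 0"
  using assms
proof (induction S rule: finite_induct)
  case empty
  show ?case by simp
next
  case (insert y S)
  have "f y b = - f b y" if "b \<in> S" for b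
    using insert.hyps(2) that by (intro insert.prems(2)) auto
  then have "(\<Sum>b\<in>S. f y b) = (\<Sum>b\<in>S. - f b y)"
    by (rule sum.cong[OF refl])
  moreover have "(\<Sum>a\<in>S. \<Sum>b\<in>S. f a b) = 0"
    using insert.prems by (intro insert.IH) (simp, rule insert.prems(2), simp_all)
  moreover have "f y y = 0"
    by (rule insert.prems(1)) simp
  ultimately show ?case
    using insert.hyps by (simp add: sum.distrib sum_negf)
qed

text \<open>The central elements \<open>w\<close> and \<open>u\<close> stand for \<open>\<epsilon>\<close> and \<open>1\<close>, and \<open>H\<close> for half the sum of the squares
  of the \<open>p i\<close>.  The class \<^class>\<open>ring\<close> has no unit, so all scalars are elements of the ring.\<close>

locale xp_clifford =
  fixes I :: "'i set" and x p e :: "'i \<Rightarrow> 'a::ring" and H w u :: 'a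
  assumes finite_I: "finite I"
    and xx: "\<lbrakk>i \<in> I; j \<in> I\<rbrakk> \<Longrightarrow> x i * x j = x j * x i"
    and pp: "\<lbrakk>i \<in> I; j \<in> I\<rbrakk> \<Longrightarrow> p i * p j = p j * p i"
    and Hx: "j \<in> I \<Longrightarrow> H * x j - x j * H = p j"
    and H: "H + H = (\<Sum>i\<in>I. p i * p i)"
    and ex: "\<lbrakk>i \<in> I; j \<in> I\<rbrakk> \<Longrightarrow> e i * x j = x j * e i"
    and ep: "\<lbrakk>i \<in> I; j \<in> I\<rbrakk> \<Longrightarrow> e i * p j = p j * e i"
    and ee: "\<lbrakk>i \<in> I; j \<in> I; i \<noteq> j\<rbrakk> \<Longrightarrow> e i * e j = - (e j * e i)"
    and esq: "i \<in> I \<Longrightarrow> e i * e i = w"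
    and w: "w * y = y * w"
    and u: "u * y = y * u"
    and eu: "i \<in> I \<Longrightarrow> e i * u = e i"
begin

section \<open>The elements \<open>Q a\<close>, their components, and their relations with
  \<open>D\<close> and \<open>x b\<close>\<close>

definition D :: 'a where "D = (\<Sum>i\<in>I. e i * p i)"
definition Q :: "'i \<Rightarrow> 'a" where "Q a = D * x a - x a * D - e a"
text \<open>The deviation from the canonical commutation relations: in the Weyl algebra, with p i
  the derivative along x i, it vanishes.\<close>

definition q :: "'i \<Rightarrow> 'i \<Rightarrow> 'a" where "q a i = p i * x a - x a * p i - (if i = a then u else 0)"

lemma w_left: "y * (w * z) = w * (y * z)"
  by (simp add: w[symmetric] flip: mult.assoc)

lemma ex_left: "\<lbrakk>i \<in> I; j \<in> I\<rbrakk> \<Longrightarrow> e i * (x j * y) = x j * (e i * y)"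
  by (simp add: ex flip: mult.assoc)

lemma ep_left: "\<lbrakk>i \<in> I; j \<in> I\<rbrakk> \<Longrightarrow> e i * (p j * y) = p j * (e i * y)"
  by (simp add: ep flip: mult.assoc)

text \<open>By \<open>Hx\<close> the commutator [p i, x a] is the double commutator [[H, x i], x a],
  and \<open>x i\<close> commutes with \<open>x a\<close>.\<close>

lemma q_sym:
  assumes "a \<in> I" "i \<in> I"
  shows "q a i = q i a"
proof -
  have "p i * x a - x a * p i = p a * x i - x i * p a"
    unfolding Hx[OF assms(1), symmetric] Hx[OF assms(2), symmetric]
    using arg_cong[OF xx[OF assms], of "\<lambda>y. H * y"] arg_cong[OF xx[OF assms], of "\<lambda>y. y * H"]
    by (simp add: algebra_simps)
  then show ?thesis by (simp add: q_def)
qed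

lemma e_q:
  assumes "a \<in> I" "i \<in> I" "j \<in> I"
  shows "e j * q a i = q a i * e j"
proof -
  have "e j * (p i * x a) = p i * x a * e j" "e j * (x a * p i) = x a * p i * e j"
    using assms by (simp_all add: ex ex_left ep ep_left mult.assoc)
  then show ?thesis by (simp add: q_def algebra_simps u)
qed

lemma q_e:
  assumes "a \<in> I" "i \<in> I" "j \<in> I"
  shows "q a i * (e j * y) = e j * (q a i * y)"
  using assms by (simp add: e_q flip: mult.assoc)

text \<open>The delta term of \<open>q a i\<close> contributes \<open>e a * u = e a\<close>, which
  is the correction subtracted in \<open>Q a\<close>.\<close>

lemma Q_eq:
  assumes "a \<in> I"
  shows "Q a = (\<Sum>i\<in>I. e i * q a i)"
proof -
  have "e i * q a i = e i * p i * x a - x a * (e i * p i) - (if i = a then e a else 0)" if "i \<in> I" for i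
    using that assms by (simp add: q_def right_diff_distrib ex_left eu mult.assoc)
  then show ?thesis
    using assms finite_I
    by (simp add: Q_def D_def sum_subtractf sum_distrib_left sum_distrib_right sum.delta)
qed

text \<open>Off the diagonal \<open>e i * e j\<close> is antisymmetric and \<open>p i * p j\<close>
  symmetric. The expected diagonal is subtracted inside the double sum, so that
  \<open>sum_antisym_eq_0\<close> disposes of everything at once.\<close>

lemma D_sq: "D * D = w * (H + H)"
proof -
  have "D * D - w * (H + H) =
      (\<Sum>i\<in>I. \<Sum>j\<in>I. e i * p i * (e j * p j) - (if i = j then w * (p i * p i) else 0))"
    using finite_I by (simp add: H D_def sum_product sum_subtractf sum_distrib_left[of w])
  also have "\<dots> = (\<Sum>i\<in>I. \<Sum>j\<in>I. e i * e j * (p i * p j) - (if i = j then w * (p i * p i) else 0))"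
    by (intro sum.cong refl) (simp add: ep ep_left mult.assoc)
  also have "\<dots> = 0"
  proof (rule sum_antisym_eq_0[OF finite_I])
    fix i j assume ij: "i \<in> I" "j \<in> I" "i \<noteq> j"
    show "e i * e j * (p i * p j) - (if i = j then w * (p i * p i) else 0) =
        - (e j * e i * (p j * p i) - (if j = i then w * (p j * p j) else 0))"
      unfolding ee[OF ij] pp[OF ij(1,2)] using ij by simp
  qed (simp add: esq)
  finally show ?thesis by simp
qed

lemma e_D:
  assumes "a \<in> I"
  shows "e a * D + D * e a = w * (p a + p a)"
proof -
  have "e a * (e i * p i) + e i * p i * e a = (if i = a then w * (p a + p a) else 0)"
    if "i \<in> I" for i
  proof (cases "i = a")
    case True
    have "e a * (e a * p a) = w * p a"
      by (simp add: esq[OF assms] flip: mult.assoc)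
    moreover from this have "e a * p a * e a = w * p a"
      by (simp add: ep[OF assms assms, symmetric] mult.assoc)
    ultimately show ?thesis using True by (simp add: distrib_left)
  next
    case False
    have "e i * p i * e a = e i * e a * p i"
      by (simp add: ep[OF assms that, symmetric] mult.assoc)
    also have "\<dots> = - (e a * e i) * p i"
      using ee[of i a] that assms False by simp
    finally show ?thesis using False by (simp add: mult.assoc)
  qed
  then show ?thesis
    using assms finite_I
    by (simp add: D_def sum_distrib_left sum_distrib_right flip: sum.distrib)
qed

text \<open>The term \<open>e a\<close> in \<open>Q a\<close> is chosen for this: the anticommutator
  of \<open>Q a\<close> and \<open>D\<close> is the commutator of \<open>D * D\<close> with
  \<open>x a\<close> minus the anticommutator of \<open>e a\<close> and \<open>D\<close>, and both
  are \<open>w * (p a + p a)\<close>.\<close>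

lemma Q_D:
  assumes "a \<in> I"
  shows "Q a * D = - (D * Q a)"
proof -
  have "Q a * D + D * Q a = D * D * x a - x a * (D * D) - (e a * D + D * e a)"
    by (simp add: Q_def algebra_simps)
  also have "D * D * x a - x a * (D * D) = w * ((H * x a - x a * H) + (H * x a - x a * H))"
    by (simp add: D_sq w_left[of "x a"] algebra_simps)
  finally show ?thesis
    using assms by (simp add: Hx e_D eq_neg_iff_add_eq_0)
qed

text \<open>Because \<open>e a\<close> commutes with \<open>x b\<close>, only the double commutator
  [[D, x a], x b] is left, and the \<open>x\<close> commute with each other.\<close>

lemma Q_x_sym:
  assumes "a \<in> I" "b \<in> I"
  shows "Q a * x b - x b * Q a = Q b * x a - x a * Q b"
  using arg_cong[OF xx[OF assms], of "\<lambda>y. D * y"] arg_cong[OF xx[OF assms], of "\<lambda>y. y * D"] ex assms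
  by (simp add: Q_def algebra_simps)

end

text \<open>Here \<open>g\<close> stands for \<open>e\<^sub>A\<close>, \<open>h\<close> for \<open>1/2\<close> and \<open>s\<close> for the sign \<open>(-1)\<close> to the power \<open>|A| - 1\<close>.\<close>

locale xp_clifford_list = xp_clifford I x p e H w u
  for I :: "'i set" and x p e :: "'i \<Rightarrow> 'a::ring" and H w u :: 'a +
  fixes A :: "'i set" and g s h :: 'a
  assumes A: "A \<subseteq> I"
    and s: "s * y = y * s"
    and h: "h * y = y * h"
    and ssg: "s * (s * g) = g"
    and ge_in: "i \<in> A \<Longrightarrow> g * e i = s * (e i * g)"
    and ge_notin: "i \<in> I - A \<Longrightarrow> g * e i = - (s * (e i * g))"
    and gx: "i \<in> I \<Longrightarrow> g * x i = x i * g"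
    and gp: "i \<in> I \<Longrightarrow> g * p i = p i * g"
begin

text \<open>For \<open>a\<close> in \<open>A\<close> this is the product x_S E in the operator with
  subscripts a, A: there S = A - {a} and E = e_a e_A.\<close>

definition Y :: "'i \<Rightarrow> 'a" where "Y a = (\<Sum>b\<in>A-{a}. x b * e b) * (e a * g)"

section \<open>Passing \<open>g\<close> through the generators, and the sums over
  \<open>A\<close>\<close>

lemma s_left: "y * (s * z) = s * (y * z)"
  by (simp add: s[symmetric] flip: mult.assoc)

lemma h_left: "y * (h * z) = h * (y * z)"
  by (simp add: h[symmetric] flip: mult.assoc)

lemma gx_left: "i \<in> I \<Longrightarrow> g * (x i * y) = x i * (g * y)"
  by (simp add: gx flip: mult.assoc)

lemma gp_left: "i \<in> I \<Longrightarrow> g * (p i * y) = p i * (g * y)"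
  by (simp add: gp flip: mult.assoc)

lemma finite_A: "finite A"
  using A finite_I finite_subset by blast

lemma g_q:
  assumes "a \<in> I" "i \<in> I"
  shows "g * q a i = q a i * g"
proof -
  have "g * (p i * x a) = p i * x a * g" "g * (x a * p i) = x a * p i * g"
    using assms by (simp_all add: gx gx_left gp gp_left mult.assoc)
  then show ?thesis by (simp add: q_def algebra_simps u)
qed

text \<open>Moving \<open>g\<close> past \<open>e i\<close> yields \<open>s\<close> inside
  \<open>A\<close> and \<open>- s\<close> outside. Together with the prefactor this is
  \<open>s * s\<close>, which \<open>ssg\<close> removes once it stands next to \<open>g\<close>; in
  a ring without unit \<open>ssg\<close> takes the place of s * s = 1.\<close>

lemma s_g_Q:
  assumes "a \<in> A"
  shows "s * (g * Q a) = (\<Sum>i\<in>A. e i * q a i * g) - (\<Sum>i\<in>I-A. e i * q a i * g)"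
proof -
  have 1: "s * (g * (e i * q a i)) = e i * q a i * g" if "i \<in> A" for i
  proof -
    have "g * (e i * q a i) = s * (e i * (g * q a i))"
      by (simp add: ge_in[OF that] flip: mult.assoc)
    then have "s * (g * (e i * q a i)) = s * (s * (e i * (g * q a i)))" by simp
    also have "\<dots> = e i * (s * (s * g)) * q a i"
      by (simp add: s_left[of "e i"] mult.assoc)
    finally show ?thesis
      using ssg g_q A assms that by (simp add: mult.assoc subset_iff)
  qed
  have 2: "s * (g * (e i * q a i)) = - (e i * q a i * g)" if "i \<in> I - A" for i
  proof -
    have "g * (e i * q a i) = - (s * (e i * (g * q a i)))"
      by (simp add: ge_notin[OF that] flip: mult.assoc)
    then have "s * (g * (e i * q a i)) = - (s * (s * (e i * (g * q a i))))" by simp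
    also have "s * (s * (e i * (g * q a i))) = e i * (s * (s * g)) * q a i"
      by (simp add: s_left[of "e i"] mult.assoc)
    finally show ?thesis
      using ssg g_q A assms that by (simp add: mult.assoc subset_iff)
  qed
  have "s * (g * Q a) = (\<Sum>i\<in>I. s * (g * (e i * q a i)))"
    using A assms by (simp add: Q_eq subset_iff sum_distrib_left)
  also have "\<dots> = (\<Sum>i\<in>A. s * (g * (e i * q a i))) + (\<Sum>i\<in>I-A. s * (g * (e i * q a i)))"
    using sum.subset_diff[OF A finite_I] by (simp add: add.commute)
  finally show ?thesis
    by (simp add: 1 2 sum_negf)
qed

text \<open>For \<open>i\<close> outside \<open>A\<close>, anticommuting \<open>e i\<close> with
  \<open>e a\<close> reproduces the minus sign of \<open>s_g_Q\<close>, so the two terms of the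
  difference agree. Inside \<open>A\<close> the commutator of \<open>e i\<close> and
  \<open>e a\<close> remains, antisymmetric against the symmetric \<open>q a i\<close>.\<close>

lemma sum_Q_e_g: "(\<Sum>a\<in>A. Q a * (e a * g) - s * (e a * g * Q a)) = 0"
proof -
  have "Q a * (e a * g) - s * (e a * g * Q a) = (\<Sum>i\<in>A. (e i * e a - e a * e i) * (q a i * g))"
    if a: "a \<in> A" for a
  proof -
    have aI: "a \<in> I" using a A by blast
    have *: "e i * q a i * (e a * g) = e i * e a * (q a i * g)" if "i \<in> I" for i
      using q_e[OF aI that aI] by (simp add: mult.assoc)
    have "Q a * (e a * g) = (\<Sum>i\<in>I. e i * e a * (q a i * g))"
      using aI * by (simp add: Q_eq sum_distrib_right)
    also have "\<dots> = (\<Sum>i\<in>A. e i * e a * (q a i * g)) + (\<Sum>i\<in>I-A. e i * e a * (q a i * g))"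
      using sum.subset_diff[OF A finite_I] by (simp add: add.commute)
    also have "(\<Sum>i\<in>I-A. e i * e a * (q a i * g)) = - (\<Sum>i\<in>I-A. e a * e i * (q a i * g))"
      unfolding sum_negf[symmetric]
    proof (intro sum.cong refl)
      fix i assume i: "i \<in> I - A"
      then have "i \<noteq> a" using a by auto
      then show "e i * e a * (q a i * g) = - (e a * e i * (q a i * g))"
        using ee[of i a] i aI by simp
    qed
    finally have 1: "Q a * (e a * g) =
      (\<Sum>i\<in>A. e i * e a * (q a i * g)) - (\<Sum>i\<in>I-A. e a * e i * (q a i * g))" by simp
    have "s * (e a * g * Q a) = e a * (s * (g * Q a))"
      by (simp add: s_left[of "e a"] mult.assoc)
    also have "\<dots> = (\<Sum>i\<in>A. e a * e i * (q a i * g)) - (\<Sum>i\<in>I-A. e a * e i * (q a i * g))"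
      by (simp add: s_g_Q[OF a] right_diff_distrib sum_distrib_left mult.assoc)
    finally show ?thesis
      unfolding 1 by (simp add: left_diff_distrib sum_subtractf)
  qed
  then have "(\<Sum>a\<in>A. Q a * (e a * g) - s * (e a * g * Q a)) =
      (\<Sum>a\<in>A. \<Sum>i\<in>A. (e i * e a - e a * e i) * (q a i * g))" by simp
  also have "\<dots> = 0"
    using A finite_A q_sym by (intro sum_antisym_eq_0) (auto simp: subset_iff left_diff_distrib)
  finally show ?thesis .
qed

lemma Y_eq: "Y a = (\<Sum>b\<in>A-{a}. x b * (e b * (e a * g)))"
  by (simp add: Y_def sum_distrib_right mult.assoc)

lemma sum_neq_antisym_eq_0:
  fixes f :: "'i \<Rightarrow> 'i \<Rightarrow> 'a"
  assumes "\<And>a b. \<lbrakk>a \<in> A; b \<in> A; a \<noteq> b\<rbrakk> \<Longrightarrow> f a b = - f b a"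
  shows "(\<Sum>a\<in>A. \<Sum>b\<in>A-{a}. f a b) = 0"
proof -
  have "A - {a} = {b \<in> A. a \<noteq> b}" for a by auto
  then have "(\<Sum>a\<in>A. \<Sum>b\<in>A-{a}. f a b) = (\<Sum>a\<in>A. \<Sum>b\<in>A. if a \<noteq> b then f a b else 0)"
    using finite_A by (simp only: sum.inter_filter)
  also have "\<dots> = 0"
  proof (rule sum_antisym_eq_0[OF finite_A])
    fix a b assume "a \<in> A" "b \<in> A" "a \<noteq> b"
    then show "(if a \<noteq> b then f a b else 0) = - (if b \<noteq> a then f b a else 0)"
      using assms[of a b] by simp
  qed simp
  finally show ?thesis .
qed

text \<open>An \<open>e i\<close> with \<open>i\<close> outside \<open>A\<close> passes the two
  factors \<open>e b * e a\<close> without change of sign, so the minus sign of \<open>s_g_Q\<close>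
  now makes the sum cancel there, not the difference.\<close>

lemma Q_e_e_g:
  assumes a: "a \<in> A" and b: "b \<in> A" and ab: "a \<noteq> b"
  shows "Q a * (e b * (e a * g)) + s * (e b * (e a * g) * Q a) =
     (\<Sum>i\<in>A-{b}. (e i * e b * e a + e b * e a * e i) * (q a i * g))"
proof -
  have aI: "a \<in> I" and bI: "b \<in> I" using a b A by auto
  have *: "e i * q a i * (e b * (e a * g)) = e i * e b * e a * (q a i * g)" if "i \<in> I" for i
    using q_e[OF aI that aI] q_e[OF aI that bI] by (simp add: mult.assoc)
  have "Q a * (e b * (e a * g)) = (\<Sum>i\<in>I. e i * e b * e a * (q a i * g))"
    using aI * by (simp add: Q_eq sum_distrib_right)
  also have "\<dots> = (\<Sum>i\<in>A. e i * e b * e a * (q a i * g)) + (\<Sum>i\<in>I-A. e i * e b * e a * (q a i * g))"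
    using sum.subset_diff[OF A finite_I] by (simp add: add.commute)
  also have "(\<Sum>i\<in>I-A. e i * e b * e a * (q a i * g)) = (\<Sum>i\<in>I-A. e b * e a * e i * (q a i * g))"
  proof (intro sum.cong refl)
    fix i assume "i \<in> I - A"
    then have iI: "i \<in> I" and i: "i \<noteq> b" "i \<noteq> a" using a b by auto
    have "e i * e b * e a = - (e b * (e i * e a))"
      unfolding ee[OF iI bI i(1)] by (simp add: mult.assoc)
    also have "\<dots> = e b * e a * e i"
      unfolding ee[OF iI aI i(2)] by (simp add: mult.assoc)
    finally show "e i * e b * e a * (q a i * g) = e b * e a * e i * (q a i * g)" by simp
  qed
  finally have 1: "Q a * (e b * (e a * g)) =
      (\<Sum>i\<in>A. e i * e b * e a * (q a i * g)) + (\<Sum>i\<in>I-A. e b * e a * e i * (q a i * g))" .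
  have "s * (e b * (e a * g) * Q a) = e b * (e a * (s * (g * Q a)))"
    by (simp add: s_left[of "e a"] s_left[of "e b"] mult.assoc)
  also have "\<dots> = (\<Sum>i\<in>A. e b * e a * e i * (q a i * g)) - (\<Sum>i\<in>I-A. e b * e a * e i * (q a i * g))"
    by (simp add: s_g_Q[OF a] right_diff_distrib sum_distrib_left mult.assoc)
  finally have "Q a * (e b * (e a * g)) + s * (e b * (e a * g) * Q a) =
     (\<Sum>i\<in>A. (e i * e b * e a + e b * e a * e i) * (q a i * g))"
    unfolding 1 by (simp add: distrib_right sum.distrib)
  \<comment> \<open>Without \<open>i = b\<close> the index \<open>i\<close> has the range that
    \<open>a\<close> has for fixed \<open>b\<close>. The term \<open>i = a\<close> is kept, so that
    the later double sum over \<open>a\<close> and \<open>i\<close> runs over a full square.\<close>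
  also have "e b * e b * e a + e b * e a * e b = 0"
    using ee[OF aI bI ab] by (simp add: mult.assoc)
  then have "(\<Sum>i\<in>A. (e i * e b * e a + e b * e a * e i) * (q a i * g)) =
      (\<Sum>i\<in>A-{b}. (e i * e b * e a + e b * e a * e i) * (q a i * g))"
    using finite_A by (intro sum.mono_neutral_right) auto
  finally show ?thesis .
qed

text \<open>Moving \<open>Q a\<close> past \<open>x b\<close> splits a summand into
  \<open>K\<close>, which contains the commutator, and a rest \<open>L\<close>. In \<open>K\<close>
  the symmetric commutator meets the antisymmetric \<open>e b * e a\<close>.\<close>

lemma sum_Q_Y: "(\<Sum>a\<in>A. Q a * Y a + s * (Y a * Q a)) = 0"
proof -
  define K where "K a b = (Q a * x b - x b * Q a) * (e b * (e a * g))" for a b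
  define L where "L a b = x b * (Q a * (e b * (e a * g)) + s * (e b * (e a * g) * Q a))" for a b
  have "Q a * (x b * y) + s * (x b * y * Q a) =
      (Q a * x b - x b * Q a) * y + x b * (Q a * y + s * (y * Q a))" for a b y
    by (simp add: s_left[of "x b"] algebra_simps)
  then have "(\<Sum>a\<in>A. Q a * Y a + s * (Y a * Q a)) = (\<Sum>a\<in>A. \<Sum>b\<in>A-{a}. K a b + L a b)"
    unfolding Y_eq K_def L_def sum_distrib_left sum_distrib_right sum.distrib[symmetric]
    by (intro sum.cong refl)
  also have "\<dots> = (\<Sum>a\<in>A. \<Sum>b\<in>A-{a}. K a b) + (\<Sum>a\<in>A. \<Sum>b\<in>A-{a}. L a b)"
    by (simp add: sum.distrib)
  also have "(\<Sum>a\<in>A. \<Sum>b\<in>A-{a}. K a b) = 0"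
  proof (rule sum_neq_antisym_eq_0)
    fix a b assume ab: "a \<in> A" "b \<in> A" "a \<noteq> b"
    then have I: "a \<in> I" "b \<in> I" using A by auto
    have "e b * (e a * g) = - (e a * (e b * g))"
      unfolding mult.assoc[symmetric] ee[OF I(2,1) ab(3)[symmetric]] by simp
    then show "K a b = - K b a"
      unfolding K_def Q_x_sym[OF I] by simp
  qed
  \<comment> \<open>In \<open>L\<close> the cancellation is between \<open>a\<close> and the index
    \<open>i\<close> of the expansion of \<open>Q a\<close>, at fixed \<open>b\<close>; hence
    \<open>b\<close> becomes the outer index.\<close>
  also have "(\<Sum>a\<in>A. \<Sum>b\<in>A-{a}. L a b) = (\<Sum>b\<in>A. \<Sum>a\<in>A-{b}. L a b)"
  proof -
    have "A - {a} = {b. b \<in> A \<and> a \<noteq> b}" "{b. b \<in> A \<and> b \<noteq> a} = A - {a}" for a by auto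
    then show ?thesis
      using sum.swap_restrict[OF finite_A finite_A, of L "\<lambda>a b. a \<noteq> b"] by (simp only:)
  qed
  also have "\<dots> = 0"
  proof (rule sum.neutral, rule ballI)
    fix b assume b: "b \<in> A"
    define M where "M a i = (e i * e b * e a + e b * e a * e i) * (q a i * g)" for a i
    have "(\<Sum>a\<in>A-{b}. L a b) = x b * (\<Sum>a\<in>A-{b}. \<Sum>i\<in>A-{b}. M a i)"
      unfolding L_def M_def using b
      by (subst sum_distrib_left, intro sum.cong refl arg_cong[of _ _ "\<lambda>z. x b * z"] Q_e_e_g) auto
    also have "(\<Sum>a\<in>A-{b}. \<Sum>i\<in>A-{b}. M a i) = 0"
    proof (rule sum_antisym_eq_0)
      show "finite (A - {b})" using finite_A by simp
    next
      fix a assume "a \<in> A - {b}"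
      then have "e a * e b = - (e b * e a)"
        using A b by (intro ee) auto
      then show "M a a = 0" by (simp add: M_def)
    next
      fix a i assume ai: "a \<in> A - {b}" "i \<in> A - {b}" "a \<noteq> i"
      then have I: "a \<in> I" "i \<in> I" "b \<in> I" "a \<noteq> b" "i \<noteq> b" using A b by auto
      \<comment> \<open>Since \<open>e b\<close> anticommutes with \<open>e i\<close>, the Clifford
        factor of \<open>M a i\<close> is \<open>e b\<close> times the commutator of
        \<open>e a\<close> and \<open>e i\<close>.\<close>
      show "M a i = - M i a"
        unfolding M_def q_sym[OF I(1,2)] ee[OF I(1,3,4)] ee[OF I(2,3,5)] by (simp add: algebra_simps)
    qed
    finally show "(\<Sum>a\<in>A-{b}. L a b) = 0" by simp
  qed
  finally show ?thesis by simp
qed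

text \<open>Twice the operator with subscripts a, A, with \<open>w\<close> for \<epsilon>.\<close>

definition R :: "'i \<Rightarrow> 'a" where
  "R a = D * Y a - e a * g * (\<Sum>b\<in>A-{a}. x b * e b) * D - w * (e a * g)"

text \<open>In moving \<open>e a * g\<close> past \<open>x b * e b\<close> with \<open>b\<close> in
  \<open>A - {a}\<close>, the factor \<open>g\<close> gives \<open>s\<close> and \<open>e a\<close>
  gives a minus sign.\<close>

lemma R_eq:
  assumes a: "a \<in> A"
  shows "R a = D * Y a + s * (Y a * D) - w * (e a * g)"
proof -
  have "e a * (g * (x b * e b)) = - (s * (x b * (e b * (e a * g))))" if b: "b \<in> A - {a}" for b
  proof -
    have I: "a \<in> I" "b \<in> I" "a \<noteq> b" using a b A by auto
    have "e a * (g * (x b * e b)) = x b * (e a * (g * e b))"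
    proof -
      have "g * (x b * e b) = x b * (g * e b)" "e a * (x b * z) = x b * (e a * z)" for z
        using gx[OF I(2)] ex[OF I(1,2)] by (simp_all flip: mult.assoc)
      then show ?thesis by simp
    qed
    also have "\<dots> = s * (x b * (e a * e b * g))"
      using ge_in[of b] b by (simp add: s_left[of "e a"] s_left[of "x b"] mult.assoc)
    finally show ?thesis using ee[OF I] by (simp add: mult.assoc)
  qed
  then have "e a * g * (\<Sum>b\<in>A-{a}. x b * e b) = - (s * Y a)"
    by (simp add: Y_eq sum_distrib_left mult.assoc flip: sum_negf)
  then show ?thesis by (simp add: R_def mult.assoc)
qed

text \<open>\<open>D\<close> does not depend on \<open>a\<close>, so it factors out of the sum as
  soon as it stands at the outer left or right of each summand.\<close>

lemma sum_Q_R: "(\<Sum>a\<in>A. Q a * R a - s * (R a * Q a)) = 0"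
proof -
  have "Q a * R a - s * (R a * Q a) =
      s * (Q a * Y a + s * (Y a * Q a)) * D - D * (Q a * Y a + s * (Y a * Q a))
      - w * (Q a * (e a * g) - s * (e a * g * Q a))" if "a \<in> A" for a
  proof -
    \<comment> \<open>Both orientations are needed: in \<open>Q a * D * Y a\<close> the factor
      \<open>D\<close> moves left, in \<open>Y a * D * Q a\<close> it moves right.\<close>
    have QD: "Q a * D = - (D * Q a)" "D * Q a = - (Q a * D)"
      using Q_D that A by auto
    have 1: "Q a * (D * y) = - (D * (Q a * y))" for y
      by (simp add: QD(1) flip: mult.assoc)
    have 2: "s * (Y a * D * Q a) = - (s * (Y a * Q a * D))"
      by (simp add: QD(2) mult.assoc)
    have 3: "Q a * (s * y) = s * (Q a * y)" "D * (s * y) = s * (D * y)"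
       "Q a * (w * y) = w * (Q a * y)" "s * (w * y) = w * (s * y)" for y
      by (rule s_left w_left)+
    show ?thesis
      unfolding R_eq[OF that]
      using 2 by (simp add: algebra_simps 1 3)
  qed
  then have "(\<Sum>a\<in>A. Q a * R a - s * (R a * Q a)) =
      s * (\<Sum>a\<in>A. Q a * Y a + s * (Y a * Q a)) * D - D * (\<Sum>a\<in>A. Q a * Y a + s * (Y a * Q a))
      - w * (\<Sum>a\<in>A. Q a * (e a * g) - s * (e a * g * Q a))"
    by (simp only: sum_distrib_left sum_distrib_right flip: sum_subtractf cong: sum.cong)
  then show ?thesis by (simp add: sum_Q_Y sum_Q_e_g)
qed

text \<open>Two factors \<open>e a\<close> multiply to \<open>w\<close>, so \<open>O1 a\<close> is
  \<open>h * (w * Q a)\<close>, and the central factor \<open>h * h * w\<close> is common to all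
  summands.\<close>

lemma sum_supercommutator:
  defines "O1 a \<equiv> h * (D * (x a * e a) * e a - e a * (x a * e a) * D - w * e a)"
    and "O2 a \<equiv> h * (D * (\<Sum>b\<in>A-{a}. x b * e b) * (e a * g)
                  - e a * g * (\<Sum>b\<in>A-{a}. x b * e b) * D - w * (e a * g))"
  shows "(\<Sum>a\<in>A. O1 a * O2 a - s * (O2 a * O1 a)) = 0"
proof -
  have "O1 a * O2 a - s * (O2 a * O1 a) = h * h * w * (Q a * R a - s * (R a * Q a))"
    if a: "a \<in> A" for a
  proof -
    have aI: "a \<in> I" using a A by blast
    have "D * (x a * e a) * e a = w * (D * x a)"
      by (simp add: mult.assoc esq[OF aI] w)
    moreover have "e a * (x a * e a) * D = w * (x a * D)"
    proof -
      have "e a * (x a * e a) = x a * w"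
        unfolding esq[OF aI, symmetric] by (simp add: ex[OF aI aI] flip: mult.assoc)
      then show ?thesis by (simp add: w mult.assoc)
    qed
    ultimately have "O1 a = h * (w * Q a)"
      by (simp add: O1_def Q_def right_diff_distrib)
    moreover have "O2 a = h * R a"
      by (simp add: O2_def R_def Y_def mult.assoc)
    moreover have "h * (w * Q a) * (h * R a) = h * h * w * (Q a * R a)"
      "s * (h * R a * (h * (w * Q a))) = h * h * w * (s * (R a * Q a))"
      by (simp_all add: h_left[of "Q a"] h_left[of "R a"] h_left[of w] h_left[of s]
          w_left[of "R a"] w_left[of s] mult.assoc)
    ultimately show ?thesis by (simp add: right_diff_distrib)
  qed
  then show ?thesis
    by (simp add: sum_Q_R flip: sum_distrib_left)
qed

end

section \<open>Embedding a ring into a type of class ring\<close>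

text \<open>A ring of \<^theory>\<open>HOL-Algebra.Ring\<close> is a record with a carrier and not a type.  To compute in the
  type class \<^class>\<open>ring\<close>, it is embedded as one factor of the product of all rings on the same
  underlying type.  The embedding does not preserve the unit, so the image of the unit appears
  as a separate central element.\<close>

typedef ('a, 'm) ring_family =
  "{f :: ('a, 'm) ring_scheme \<Rightarrow> 'a. \<forall>R. if ring R then f R \<in> carrier R else f R = undefined}"
  by (rule exI[of _ "\<lambda>R. if ring R then \<zero>\<^bsub>R\<^esub> else undefined"]) (simp add: ring.ring_simprules)

setup_lifting type_definition_ring_family

text \<open>At records that are not rings every member has the same fixed value; otherwise a law
  such as \<open>0 + a = a\<close> would fail at these arguments.\<close>

instantiation ring_family :: (type, type) ring
begin

lift_definition zero_ring_family :: "('a, 'm) ring_family"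
  is "\<lambda>R. if ring R then \<zero>\<^bsub>R\<^esub> else undefined"
  by (simp add: ring.ring_simprules)

lift_definition plus_ring_family :: "('a, 'm) ring_family \<Rightarrow> ('a, 'm) ring_family \<Rightarrow> ('a, 'm) ring_family"
  is "\<lambda>f g R. if ring R then f R \<oplus>\<^bsub>R\<^esub> g R else undefined"
  by (simp add: ring.ring_simprules)

lift_definition uminus_ring_family :: "('a, 'm) ring_family \<Rightarrow> ('a, 'm) ring_family"
  is "\<lambda>f R. if ring R then \<ominus>\<^bsub>R\<^esub> f R else undefined"
  by (simp add: ring.ring_simprules)

lift_definition minus_ring_family :: "('a, 'm) ring_family \<Rightarrow> ('a, 'm) ring_family \<Rightarrow> ('a, 'm) ring_family"
  is "\<lambda>f g R. if ring R then f R \<ominus>\<^bsub>R\<^esub> g R else undefined"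
  by (simp add: ring.ring_simprules)

lift_definition times_ring_family :: "('a, 'm) ring_family \<Rightarrow> ('a, 'm) ring_family \<Rightarrow> ('a, 'm) ring_family"
  is "\<lambda>f g R. if ring R then f R \<otimes>\<^bsub>R\<^esub> g R else undefined"
  by (simp add: ring.ring_simprules)

instance
proof
  fix a b c :: "('a, 'm) ring_family"
  show "a + b + c = a + (b + c)"
    by transfer (auto simp: fun_eq_iff ring.ring_simprules)
  show "a + b = b + a"
    by transfer (auto simp: fun_eq_iff ring.ring_simprules)
  show "0 + a = a"
    by transfer (auto simp: fun_eq_iff ring.ring_simprules split: if_splits)
  show "- a + a = 0"
    by transfer (auto simp: fun_eq_iff ring.ring_simprules)
  show "a - b = a + - b"
    by transfer (auto simp: fun_eq_iff a_minus_def)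
  show "a * b * c = a * (b * c)"
    by transfer (auto simp: fun_eq_iff ring.ring_simprules)
  show "(a + b) * c = a * c + b * c"
    by transfer (auto simp: fun_eq_iff ring.ring_simprules)
  show "a * (b + c) = a * b + a * c"
    by transfer (auto simp: fun_eq_iff ring.ring_simprules)
qed

end

text \<open>Zero in the other components keeps sums and products but not the unit. Zero is also the
  default outside the carrier, as the result has to lie in the family.\<close>

lift_definition ring_family_single :: "('a, 'm) ring_scheme \<Rightarrow> 'a \<Rightarrow> ('a, 'm) ring_family"
  is "\<lambda>R r R'. if ring R' then (if R' = R \<and> r \<in> carrier R then r else \<zero>\<^bsub>R'\<^esub>) else undefined"
  by (auto simp: ring.ring_simprules)

context ring
begin

lemma ring_family_single_inject:
  assumes "a \<in> carrier R" "b \<in> carrier R" "ring_family_single R a = ring_family_single R b"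
  shows "a = b"
  proof -
  have "Rep_ring_family (ring_family_single R a) R = Rep_ring_family (ring_family_single R b) R"
    using assms(3) by simp
  then show ?thesis
    using assms(1,2) ring_axioms by (simp add: ring_family_single.rep_eq)
qed

lemma ring_family_single_add:
  assumes "a \<in> carrier R" "b \<in> carrier R"
  shows "ring_family_single R (a \<oplus> b) = ring_family_single R a + ring_family_single R b"
  using assms by transfer (auto simp: fun_eq_iff ring.ring_simprules)

lemma ring_family_single_mult:
  assumes "a \<in> carrier R" "b \<in> carrier R"
  shows "ring_family_single R (a \<otimes> b) = ring_family_single R a * ring_family_single R b"
  using assms by transfer (auto simp: fun_eq_iff ring.ring_simprules)

text \<open>Centrality holds against the whole product and not only against the image of
  \<open>R\<close>, because in every other component both sides are zero.\<close>

lemma ring_family_single_central: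
  assumes "c \<in> carrier R" "\<And>a. a \<in> carrier R \<Longrightarrow> c \<otimes> a = a \<otimes> c"
  shows "ring_family_single R c * y = y * ring_family_single R c"
  using assms by transfer (auto simp: fun_eq_iff ring.ring_simprules)

end

locale assoc_algebra = ring M for M :: "('k::field, 'a) module" (structure) +
  assumes smult_closed [simp, intro]: "a \<in> carrier M \<Longrightarrow> c \<odot> a \<in> carrier M"
    and smult_l_distr: "a \<in> carrier M \<Longrightarrow> (c + d) \<odot> a = c \<odot> a \<oplus> d \<odot> a"
    and smult_r_distr: "\<lbrakk>a \<in> carrier M; b \<in> carrier M\<rbrakk> \<Longrightarrow> c \<odot> (a \<oplus> b) = c \<odot> a \<oplus> c \<odot> b"
    and smult_assoc: "a \<in> carrier M \<Longrightarrow> (c * d) \<odot> a = c \<odot> (d \<odot> a)"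
    and smult_one [simp]: "a \<in> carrier M \<Longrightarrow> 1 \<odot> a = a"
    and smult_mult_left: "\<lbrakk>a \<in> carrier M; b \<in> carrier M\<rbrakk> \<Longrightarrow> (c \<odot> a) \<otimes> b = c \<odot> (a \<otimes> b)"
    and smult_mult_right: "\<lbrakk>a \<in> carrier M; b \<in> carrier M\<rbrakk> \<Longrightarrow> a \<otimes> (c \<odot> b) = c \<odot> (a \<otimes> b)"

section \<open>Quotient algebras and their representations\<close>

text \<open>Supports may be enlarged to any finite sets, so that factors with different supports can
  be summed over a common one.\<close>

lemma mult_monoid_algebra:
  assumes "finite U" "finite V" "Poly_Mapping.keys f \<subseteq> U" "Poly_Mapping.keys g \<subseteq> V"
  shows "f \<otimes>\<^bsub>monoid_algebra G\<^esub> g =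
    (\<Sum>u\<in>U. \<Sum>v\<in>V. Poly_Mapping.single (u \<otimes>\<^bsub>G\<^esub> v) (Poly_Mapping.lookup f u * Poly_Mapping.lookup g v))"
proof -
  have "(\<Sum>u\<in>U. \<Sum>v\<in>V. Poly_Mapping.single (u \<otimes>\<^bsub>G\<^esub> v) (Poly_Mapping.lookup f u * Poly_Mapping.lookup g v)) =
    (\<Sum>u\<in>Poly_Mapping.keys f. \<Sum>v\<in>V. Poly_Mapping.single (u \<otimes>\<^bsub>G\<^esub> v) (Poly_Mapping.lookup f u * Poly_Mapping.lookup g v))"
    using assms by (intro sum.mono_neutral_right) (auto simp: in_keys_iff)
  also have "\<dots> = (\<Sum>u\<in>Poly_Mapping.keys f. \<Sum>v\<in>Poly_Mapping.keys g.
      Poly_Mapping.single (u \<otimes>\<^bsub>G\<^esub> v) (Poly_Mapping.lookup f u * Poly_Mapping.lookup g v))"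
    using assms by (intro sum.cong sum.mono_neutral_right) (auto simp: in_keys_iff)
  finally show ?thesis by (simp add: monoid_algebra_def)
qed

lemma monoid_algebra_mult_add_left:
  "(f + f') \<otimes>\<^bsub>monoid_algebra G\<^esub> g = f \<otimes>\<^bsub>monoid_algebra G\<^esub> g + f' \<otimes>\<^bsub>monoid_algebra G\<^esub> g"
  using mult_monoid_algebra[of "Poly_Mapping.keys f \<union> Poly_Mapping.keys f'" "Poly_Mapping.keys g" _ g G]
    keys_add[of f f']
  by (simp add: lookup_add distrib_right single_add sum.distrib)

lemma monoid_algebra_mult_add_right:
  "f \<otimes>\<^bsub>monoid_algebra G\<^esub> (g + g') = f \<otimes>\<^bsub>monoid_algebra G\<^esub> g + f \<otimes>\<^bsub>monoid_algebra G\<^esub> g'"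
  using mult_monoid_algebra[of "Poly_Mapping.keys f" "Poly_Mapping.keys g \<union> Poly_Mapping.keys g'" f _ G]
    keys_add[of g g']
  by (simp add: lookup_add distrib_left single_add sum.distrib)

lemma monoid_algebra_mult_zero [simp]:
  "0 \<otimes>\<^bsub>monoid_algebra G\<^esub> g = 0" "f \<otimes>\<^bsub>monoid_algebra G\<^esub> 0 = 0"
  by (simp_all add: monoid_algebra_def)

lemma monoid_algebra_mult_sum_left:
  "sum f S \<otimes>\<^bsub>monoid_algebra G\<^esub> g = (\<Sum>i\<in>S. f i \<otimes>\<^bsub>monoid_algebra G\<^esub> g)"
  by (induction S rule: infinite_finite_induct) (simp_all add: monoid_algebra_mult_add_left)

lemma monoid_algebra_mult_sum_right:
  "f \<otimes>\<^bsub>monoid_algebra G\<^esub> sum g S = (\<Sum>i\<in>S. f \<otimes>\<^bsub>monoid_algebra G\<^esub> g i)"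
  by (induction S rule: infinite_finite_induct) (simp_all add: monoid_algebra_mult_add_right)

lemma monoid_algebra_mult_single:
  "Poly_Mapping.single u a \<otimes>\<^bsub>monoid_algebra G\<^esub> Poly_Mapping.single v b =
    Poly_Mapping.single (u \<otimes>\<^bsub>G\<^esub> v) (a * b)"
  by (subst mult_monoid_algebra[of "{u}" "{v}"]) auto

lemma monoid_algebra_simps:
  "carrier (monoid_algebra G) = {f. Poly_Mapping.keys f \<subseteq> carrier G}"
  "\<one>\<^bsub>monoid_algebra G\<^esub> = Poly_Mapping.single \<one>\<^bsub>G\<^esub> 1"
  "\<zero>\<^bsub>monoid_algebra G\<^esub> = 0"
  "f \<oplus>\<^bsub>monoid_algebra G\<^esub> g = f + g"
  "c \<odot>\<^bsub>monoid_algebra G\<^esub> f = Poly_Mapping.map ((*) c) f"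
  by (simp_all add: monoid_algebra_def)

lemma lookup_map_times:
  fixes f :: "'m \<Rightarrow>\<^sub>0 'k::field"
  shows "Poly_Mapping.lookup (Poly_Mapping.map ((*) c) f) m = c * Poly_Mapping.lookup f m"
  by (simp add: map.rep_eq when_def)

lemma keys_map_times: "Poly_Mapping.keys (Poly_Mapping.map ((*) (c::'k::field)) f) \<subseteq> Poly_Mapping.keys f"
  by (auto simp: in_keys_iff lookup_map_times)

lemma map_times_single:
  "Poly_Mapping.map ((*) (c::'k::field)) (Poly_Mapping.single u a) = Poly_Mapping.single u (c * a)"
  by (rule poly_mapping_eqI) (simp add: lookup_map_times lookup_single when_def)

lemma map_times_sum:
  "Poly_Mapping.map ((*) (c::'k::field)) (sum f S) = (\<Sum>i\<in>S. Poly_Mapping.map ((*) c) (f i))"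
  by (rule poly_mapping_eqI) (simp add: lookup_map_times lookup_sum sum_distrib_left)

lemma poly_mapping_sum_monomials:
  "(\<Sum>u\<in>Poly_Mapping.keys f. Poly_Mapping.single u (Poly_Mapping.lookup f u)) = f"
  by (rule poly_mapping_eqI)
    (simp add: lookup_sum lookup_single when_def sum.delta in_keys_iff)

text \<open>Unit laws and associativity reduce by bilinearity to monomials, where they are the laws
  of \<open>G\<close>.\<close>

lemma assoc_algebra_monoid_algebra:
  assumes "monoid G"
  shows "assoc_algebra (monoid_algebra G :: ('k::field, _) module)"
proof -
  interpret G: monoid G by fact
  let ?M = "monoid_algebra G :: ('k, _) module"
  have closed: "f \<otimes>\<^bsub>?M\<^esub> g \<in> carrier ?M" if "f \<in> carrier ?M" "g \<in> carrier ?M" for f g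
  proof -
    have "Poly_Mapping.keys (f \<otimes>\<^bsub>?M\<^esub> g) \<subseteq>
       (\<Union>u\<in>Poly_Mapping.keys f. \<Union>v\<in>Poly_Mapping.keys g. {u \<otimes>\<^bsub>G\<^esub> v})"
      unfolding monoid_algebra_def
      by (auto dest!: subsetD[OF keys_sum] split: if_splits) blast
    then show ?thesis
      using that by (force simp: monoid_algebra_simps)
  qed
  have one_l: "\<one>\<^bsub>?M\<^esub> \<otimes>\<^bsub>?M\<^esub> f = f" if "f \<in> carrier ?M" for f
  proof -
    have "\<one>\<^bsub>?M\<^esub> \<otimes>\<^bsub>?M\<^esub> (\<Sum>u\<in>Poly_Mapping.keys f. Poly_Mapping.single u (Poly_Mapping.lookup f u)) =
       (\<Sum>u\<in>Poly_Mapping.keys f. Poly_Mapping.single u (Poly_Mapping.lookup f u))"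
      unfolding monoid_algebra_mult_sum_right using that
      by (intro sum.cong refl) (auto simp: monoid_algebra_mult_single monoid_algebra_simps)
    then show ?thesis by (simp add: poly_mapping_sum_monomials)
  qed
  have one_r: "f \<otimes>\<^bsub>?M\<^esub> \<one>\<^bsub>?M\<^esub> = f" if "f \<in> carrier ?M" for f
  proof -
    have "(\<Sum>u\<in>Poly_Mapping.keys f. Poly_Mapping.single u (Poly_Mapping.lookup f u)) \<otimes>\<^bsub>?M\<^esub> \<one>\<^bsub>?M\<^esub> =
       (\<Sum>u\<in>Poly_Mapping.keys f. Poly_Mapping.single u (Poly_Mapping.lookup f u))"
      unfolding monoid_algebra_mult_sum_left using that
      by (intro sum.cong refl) (auto simp: monoid_algebra_mult_single monoid_algebra_simps)
    then show ?thesis by (simp add: poly_mapping_sum_monomials)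
  qed
  have assoc: "f \<otimes>\<^bsub>?M\<^esub> g \<otimes>\<^bsub>?M\<^esub> h = f \<otimes>\<^bsub>?M\<^esub> (g \<otimes>\<^bsub>?M\<^esub> h)"
    if "f \<in> carrier ?M" "g \<in> carrier ?M" "h \<in> carrier ?M" for f g h
  proof -
    let ?s = "\<lambda>f. \<Sum>u\<in>Poly_Mapping.keys f. Poly_Mapping.single u (Poly_Mapping.lookup f u)"
    have "?s f \<otimes>\<^bsub>?M\<^esub> ?s g \<otimes>\<^bsub>?M\<^esub> ?s h = ?s f \<otimes>\<^bsub>?M\<^esub> (?s g \<otimes>\<^bsub>?M\<^esub> ?s h)"
      unfolding monoid_algebra_mult_sum_left monoid_algebra_mult_sum_right using that
      by (intro sum.cong refl)
        (auto simp: monoid_algebra_mult_single monoid_algebra_simps mult.assoc subset_iff G.m_assoc)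
    then show ?thesis by (simp add: poly_mapping_sum_monomials)
  qed
  have scal: "(c \<odot>\<^bsub>?M\<^esub> f) \<otimes>\<^bsub>?M\<^esub> g = c \<odot>\<^bsub>?M\<^esub> (f \<otimes>\<^bsub>?M\<^esub> g)" "f \<otimes>\<^bsub>?M\<^esub> (c \<odot>\<^bsub>?M\<^esub> g) = c \<odot>\<^bsub>?M\<^esub> (f \<otimes>\<^bsub>?M\<^esub> g)" for c f g
  proof -
    let ?m = "Poly_Mapping.map ((*) c)"
    \<comment> \<open>The sum runs over the keys of \<open>f\<close>, since those of
      \<open>?m f\<close> disappear for \<open>c = 0\<close>.\<close>
    have "?m f \<otimes>\<^bsub>?M\<^esub> g = (\<Sum>u\<in>Poly_Mapping.keys f. \<Sum>v\<in>Poly_Mapping.keys g. Poly_Mapping.single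
        (u \<otimes>\<^bsub>G\<^esub> v) (Poly_Mapping.lookup (?m f) u * Poly_Mapping.lookup g v))"
      by (rule mult_monoid_algebra) (simp_all add: keys_map_times)
    moreover have "f \<otimes>\<^bsub>?M\<^esub> ?m g = (\<Sum>u\<in>Poly_Mapping.keys f. \<Sum>v\<in>Poly_Mapping.keys g. Poly_Mapping.single
        (u \<otimes>\<^bsub>G\<^esub> v) (Poly_Mapping.lookup f u * Poly_Mapping.lookup (?m g) v))"
      by (rule mult_monoid_algebra) (simp_all add: keys_map_times)
    moreover have "f \<otimes>\<^bsub>?M\<^esub> g = (\<Sum>u\<in>Poly_Mapping.keys f. \<Sum>v\<in>Poly_Mapping.keys g. Poly_Mapping.single
        (u \<otimes>\<^bsub>G\<^esub> v) (Poly_Mapping.lookup f u * Poly_Mapping.lookup g v))"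
      by (rule mult_monoid_algebra) simp_all
    ultimately show "(c \<odot>\<^bsub>?M\<^esub> f) \<otimes>\<^bsub>?M\<^esub> g = c \<odot>\<^bsub>?M\<^esub> (f \<otimes>\<^bsub>?M\<^esub> g)"
      "f \<otimes>\<^bsub>?M\<^esub> (c \<odot>\<^bsub>?M\<^esub> g) = c \<odot>\<^bsub>?M\<^esub> (f \<otimes>\<^bsub>?M\<^esub> g)"
      by (simp_all add: monoid_algebra_simps map_times_sum map_times_single lookup_map_times ac_simps)
  qed
  have carrier: "0 \<in> carrier ?M" "Poly_Mapping.single \<one>\<^bsub>G\<^esub> 1 \<in> carrier ?M"
      "f \<in> carrier ?M \<Longrightarrow> - f \<in> carrier ?M"
      "\<lbrakk>f \<in> carrier ?M; g \<in> carrier ?M\<rbrakk> \<Longrightarrow> f + g \<in> carrier ?M"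
      "f \<in> carrier ?M \<Longrightarrow> Poly_Mapping.map ((*) c) f \<in> carrier ?M" for c f g
    using keys_add[of f g] keys_map_times[of c f] by (auto simp: monoid_algebra_simps(1))
  have "ring ?M"
  proof (intro ringI abelian_groupI monoidI)
    show "\<exists>g\<in>carrier ?M. g \<oplus>\<^bsub>?M\<^esub> f = \<zero>\<^bsub>?M\<^esub>" if "f \<in> carrier ?M" for f
      using carrier(3)[OF that] by (intro bexI[of _ "- f"]) (simp_all add: monoid_algebra_simps)
  qed (fact closed one_l one_r assoc |
      simp add: monoid_algebra_simps(2-) carrier add_ac monoid_algebra_mult_add_left
        monoid_algebra_mult_add_right)+
  moreover have "assoc_algebra_axioms ?M"
  proof
    fix f g :: "'a \<Rightarrow>\<^sub>0 'k" and c d :: 'k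
    show "(c + d) \<odot>\<^bsub>?M\<^esub> f = c \<odot>\<^bsub>?M\<^esub> f \<oplus>\<^bsub>?M\<^esub> d \<odot>\<^bsub>?M\<^esub> f" "c \<odot>\<^bsub>?M\<^esub> (f \<oplus>\<^bsub>?M\<^esub> g) = c \<odot>\<^bsub>?M\<^esub> f \<oplus>\<^bsub>?M\<^esub> c \<odot>\<^bsub>?M\<^esub> g"
      "(c * d) \<odot>\<^bsub>?M\<^esub> f = c \<odot>\<^bsub>?M\<^esub> (d \<odot>\<^bsub>?M\<^esub> f)" "1 \<odot>\<^bsub>?M\<^esub> f = f"
      by (auto simp: monoid_algebra_simps lookup_map_times lookup_add algebra_simps intro!: poly_mapping_eqI)
  qed (rule scal | simp add: monoid_algebra_simps(5) carrier)+
  ultimately show ?thesis by (rule assoc_algebra.intro)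
qed

section \<open>Algebra homomorphisms and quotients by two-sided ideals\<close>

definition algebra_hom :: "('k, 'a) module \<Rightarrow> ('k, 'b) module \<Rightarrow> ('a \<Rightarrow> 'b) set" where
  "algebra_hom M M' = {\<phi> \<in> ring_hom M M'. \<forall>c. \<forall>a\<in>carrier M. \<phi> (c \<odot>\<^bsub>M\<^esub> a) = c \<odot>\<^bsub>M'\<^esub> \<phi> a}"

lemma quotient_algebra_simps:
  "carrier (quotient_algebra M I) = a_rcosets\<^bsub>M\<^esub> I"
  "A \<otimes>\<^bsub>quotient_algebra M I\<^esub> B = rcoset_mult M I A B"
  "A \<oplus>\<^bsub>quotient_algebra M I\<^esub> B = A <+>\<^bsub>M\<^esub> B"
  "\<one>\<^bsub>quotient_algebra M I\<^esub> = I +>\<^bsub>M\<^esub> \<one>\<^bsub>M\<^esub>"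
  "\<zero>\<^bsub>quotient_algebra M I\<^esub> = I"
  "c \<odot>\<^bsub>quotient_algebra M I\<^esub> A = (\<Union>a\<in>A. I +>\<^bsub>M\<^esub> (c \<odot>\<^bsub>M\<^esub> a))"
  by (simp_all add: quotient_algebra_def ring.extend_def module.fields_def FactRing_def)

text \<open>The quotient algebra extends the quotient ring by a scalar multiplication and so has
  another record type; the ring laws are carried over field by field.\<close>

lemma ring_cong:
  assumes "ring R" "carrier R = carrier R'" "mult R = mult R'" "one R = one R'"
    "zero R = zero R'" "add R = add R'"
  shows "ring R'"
proof -
  interpret R: ring R by fact
  show ?thesis
  proof (intro ringI abelian_groupI monoidI, unfold assms(2-)[symmetric])
    show "\<exists>y\<in>carrier R. y \<oplus>\<^bsub>R\<^esub> x = \<zero>\<^bsub>R\<^esub>" if "x \<in> carrier R" for x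
      using that by (intro bexI[of _ "\<ominus>\<^bsub>R\<^esub> x"]) (simp_all add: R.l_neg)
  qed (simp_all add: R.a_ac R.m_assoc R.l_distr R.r_distr)
qed

context assoc_algebra
begin

text \<open>Scalar multiplication by \<open>c\<close> is ring multiplication by
  \<open>c \<odot> \<one>\<close>.\<close>

lemma ideal_smult_closed:
  assumes "ideal I M" "i \<in> I"
  shows "c \<odot> i \<in> I"
proof -
  have i: "i \<in> carrier M" by (rule ideal.Icarr[OF assms])
  then have "c \<odot> i = (c \<odot> \<one>) \<otimes> i" by (simp add: smult_mult_left)
  then show ?thesis using assms i by (simp add: ideal.I_l_closed)
qed

text \<open>All representatives give the same coset, so the defining union is one over a nonempty
  constant family.\<close>

lemma quotient_smult:
  assumes "ideal I M" "a \<in> carrier M"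
  shows "c \<odot>\<^bsub>quotient_algebra M I\<^esub> (I +> a) = I +> (c \<odot> a)"
proof -
  interpret I: ideal I M by fact
  have "I +> (c \<odot> b) = I +> (c \<odot> a)" if b: "b \<in> I +> a" for b
  proof -
    obtain i where i: "i \<in> I" "b = i \<oplus> a"
      using b unfolding a_r_coset_def' by blast
    then have "c \<odot> b = c \<odot> i \<oplus> c \<odot> a" using assms(2) by (simp add: smult_r_distr)
    then have "c \<odot> b \<in> I +> (c \<odot> a)"
      using ideal_smult_closed[OF assms(1) i(1)] unfolding a_r_coset_def' by blast
    then show ?thesis
      using assms(2) by (intro a_repr_independence[OF _ _ I.a_subgroup, symmetric]) auto
  qed
  moreover have "a \<in> I +> a"
    using assms(2) I.a_rcos_self by simp
  ultimately show ?thesis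
    unfolding quotient_algebra_simps by (intro UN_constant_eq ballI)
qed

lemma quotient_hom:
  assumes "ideal I M"
  shows "(+>) I \<in> algebra_hom M (quotient_algebra M I)"
proof -
  have "(+>) I \<in> ring_hom M (M Quot I)"
    using assms by (rule ideal.rcos_ring_hom)
  then show ?thesis
    using quotient_smult[OF assms]
    by (simp add: algebra_hom_def ring_hom_def quotient_algebra_simps FactRing_def)
qed

lemma assoc_algebra_quotient:
  assumes "ideal I M"
  shows "assoc_algebra (quotient_algebra M I)"
proof -
  interpret I: ideal I M by fact
  let ?Q = "quotient_algebra M I"
  have "ring ?Q"
    by (rule ring_cong[OF I.quotient_is_ring]) (simp_all add: quotient_algebra_simps FactRing_def fun_eq_iff)
  moreover have hom: "I +> (a \<oplus> b) = (I +> a) \<oplus>\<^bsub>?Q\<^esub> (I +> b)"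
      "I +> (a \<otimes> b) = (I +> a) \<otimes>\<^bsub>?Q\<^esub> (I +> b)" "I +> (c \<odot> a) = c \<odot>\<^bsub>?Q\<^esub> (I +> a)"
    if "a \<in> carrier M" "b \<in> carrier M" for a b c
    using quotient_hom[OF assms] that by (auto simp: algebra_hom_def ring_hom_def)
  have carrier: "carrier ?Q = (+>) I ` carrier M"
    by (auto simp: quotient_algebra_simps A_RCOSETS_def')
  have "assoc_algebra_axioms ?Q"
    by (rule assoc_algebra_axioms.intro; unfold carrier)
      (auto simp: smult_l_distr smult_r_distr smult_assoc smult_mult_left smult_mult_right
        simp flip: hom)
  ultimately show ?thesis by (rule assoc_algebra.intro)
qed

lemma quotient_eq_zero:
  assumes "ideal I M" "a \<in> I"
  shows "I +> a = \<zero>\<^bsub>quotient_algebra M I\<^esub>"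
  using a_rcos_zero[OF assms] by (simp add: quotient_algebra_simps)

end

text \<open>The target has neither scalars nor a unit. The field acts through the central elements
  \<open>sc c\<close>, and \<open>sc 1\<close> is an idempotent that is a unit only on the image of
  \<open>\<phi>\<close>.\<close>

locale algebra_rep = assoc_algebra M for M :: "('k::field, 'a) module" (structure) +
  fixes sc :: "'k \<Rightarrow> 'b::ring" and \<phi> :: "'a \<Rightarrow> 'b"
  assumes sc_add: "sc (c + d) = sc c + sc d"
    and sc_mult: "sc (c * d) = sc c * sc d"
    and sc_central: "sc c * y = y * sc c"
    and rep_add: "\<lbrakk>a \<in> carrier M; b \<in> carrier M\<rbrakk> \<Longrightarrow> \<phi> (a \<oplus> b) = \<phi> a + \<phi> b"
    and rep_mult: "\<lbrakk>a \<in> carrier M; b \<in> carrier M\<rbrakk> \<Longrightarrow> \<phi> (a \<otimes> b) = \<phi> a * \<phi> b"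
    and rep_smult: "a \<in> carrier M \<Longrightarrow> \<phi> (c \<odot> a) = sc c * \<phi> a"
    and rep_one: "\<phi> \<one> = sc 1"
begin

lemma sc_left: "y * (sc c * z) = sc c * (y * z)"
  by (simp add: sc_central[symmetric] flip: mult.assoc)

lemma rep_zero: "\<phi> \<zero> = 0"
  using rep_add[of \<zero> \<zero>] by simp

lemma rep_minus:
  assumes "a \<in> carrier M" "b \<in> carrier M"
  shows "\<phi> (a \<ominus> b) = \<phi> a - \<phi> b"
proof -
  have "\<phi> (a \<ominus> b) + \<phi> b = \<phi> (a \<ominus> b \<oplus> b)"
    using assms by (simp add: rep_add)
  also have "a \<ominus> b \<oplus> b = a"
    using assms by (simp add: a_minus_def a_assoc l_neg)
  finally show ?thesis by (simp add: eq_diff_eq)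
qed

lemma rep_finsum:
  assumes "f \<in> S \<rightarrow> carrier M"
  shows "\<phi> (\<Oplus>i\<in>S. f i) = (\<Sum>i\<in>S. \<phi> (f i))"
  using assms
proof (induction S rule: infinite_finite_induct)
  case (insert i S)
  then have "f \<in> S \<rightarrow> carrier M" "f i \<in> carrier M" by auto
  then show ?case
    using insert by (simp add: finsum_insert rep_add)
qed (simp_all add: rep_zero finsum_infinite)

lemma rep_sc_one:
  assumes "a \<in> carrier M"
  shows "sc 1 * \<phi> a = \<phi> a" "\<phi> a * sc 1 = \<phi> a"
  using rep_smult[OF assms, of 1] assms sc_central[of 1 "\<phi> a"] by simp_all

lemma sc_minus: "sc (- c) = - sc c"
  using sc_add[of 0 0] sc_add[of "- c" c] by (simp add: eq_neg_iff_add_eq_0)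

lemma algebra_rep_comp:
  assumes "assoc_algebra M'" "h \<in> algebra_hom M' M"
  shows "algebra_rep M' sc (\<phi> \<circ> h)"
proof -
  interpret M': assoc_algebra M' by fact
  show ?thesis
    using assms(2) unfolding algebra_hom_def ring_hom_def
    by unfold_locales
      (auto simp: sc_add sc_mult rep_add rep_mult rep_smult rep_one Pi_iff intro: sc_central)
qed

end

lemma (in assoc_algebra) algebra_rep_single:
  "algebra_rep M (\<lambda>c. ring_family_single M (c \<odot> \<one>)) (ring_family_single M)"
proof unfold_locales
  fix c and y :: "('a, \<lparr>smult :: 'k \<Rightarrow> 'a \<Rightarrow> 'a\<rparr>) ring_family"
  show "ring_family_single M (c \<odot> \<one>) * y = y * ring_family_single M (c \<odot> \<one>)"
    by (rule ring_family_single_central) (simp_all add: smult_mult_left smult_mult_right)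
qed (simp_all add: smult_l_distr smult_assoc smult_mult_left
    flip: ring_family_single_add ring_family_single_mult)

section \<open>Free algebras and algebras given by generators and relations\<close>

lemma monoid_free_monoid: "monoid (free_monoid S)"
  by (rule monoidI) (auto simp: free_monoid_def)

lemma assoc_algebra_free_algebra: "assoc_algebra (free_algebra S :: ('k::field, _) module)"
  unfolding free_algebra_def by (rule assoc_algebra_monoid_algebra[OF monoid_free_monoid])

lemma free_gen_closed: "g \<in> S \<Longrightarrow> free_gen g \<in> carrier (free_algebra S)"
  by (simp add: free_gen_def free_algebra_def monoid_algebra_simps free_monoid_def)

context
  fixes S :: "'g set" and R :: "('g list \<Rightarrow>\<^sub>0 'k::field) set"
  assumes R: "R \<subseteq> carrier (free_algebra S)"
begin

interpretation F: assoc_algebra "free_algebra S :: ('k, 'g list \<Rightarrow>\<^sub>0 'k) module"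
  by (rule assoc_algebra_free_algebra)

lemma assoc_algebra_presented: "assoc_algebra (presented_algebra S R)"
  unfolding presented_algebra_def
  by (intro F.assoc_algebra_quotient F.genideal_ideal R)

lemma presented_hom:
  "(\<lambda>f. Idl\<^bsub>free_algebra S\<^esub> R +>\<^bsub>free_algebra S\<^esub> f) \<in> algebra_hom (free_algebra S) (presented_algebra S R)"
  unfolding presented_algebra_def
  by (intro F.quotient_hom F.genideal_ideal R)

lemma presented_relator:
  assumes "r \<in> R"
  shows "Idl\<^bsub>free_algebra S\<^esub> R +>\<^bsub>free_algebra S\<^esub> r = \<zero>\<^bsub>presented_algebra S R\<^esub>"
  unfolding presented_algebra_def
  using assms F.genideal_self[OF R] by (intro F.quotient_eq_zero F.genideal_ideal R) auto

end

section \<open>Tensor products\<close>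

context
  fixes M :: "('k::field, 'a) module" and M' :: "('k, 'b) module"
  assumes M: "assoc_algebra M" and M': "assoc_algebra M'"
begin

interpretation M: assoc_algebra M by (rule M)
interpretation M': assoc_algebra M' by (rule M')
interpretation F: assoc_algebra "monoid_algebra (M \<times>\<times> M') :: ('k, 'a \<times> 'b \<Rightarrow>\<^sub>0 'k) module"
  by (intro assoc_algebra_monoid_algebra DirProd_monoid M.monoid_axioms M'.monoid_axioms)

lemma single_closed_tensor:
  assumes "a \<in> carrier M" "b \<in> carrier M'"
  shows "Poly_Mapping.single (a, b) (c :: 'k) \<in> carrier (monoid_algebra (M \<times>\<times> M'))"
  using assms by (simp add: monoid_algebra_simps)

text \<open>The bilinearity relators use the subtraction of the type, whereas closure of the carrier
  is known for the subtraction of the ring.\<close>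

lemma tensor_minus:
  assumes "f \<in> carrier (monoid_algebra (M \<times>\<times> M'))" "g \<in> carrier (monoid_algebra (M \<times>\<times> M'))"
  shows "f \<ominus>\<^bsub>monoid_algebra (M \<times>\<times> M')\<^esub> g = f - (g :: 'a \<times> 'b \<Rightarrow>\<^sub>0 'k)"
proof -
  have "(f \<ominus>\<^bsub>monoid_algebra (M \<times>\<times> M')\<^esub> g) \<oplus>\<^bsub>monoid_algebra (M \<times>\<times> M')\<^esub> g = f"
    using assms by (simp add: a_minus_def F.a_assoc F.l_neg)
  then show ?thesis
    by (simp add: monoid_algebra_simps(4) eq_diff_eq)
qed

lemma bilinearity_relators_closed:
  "bilinearity_relators M M' \<subseteq> carrier (monoid_algebra (M \<times>\<times> M'))"
  unfolding bilinearity_relators_def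
  by (auto simp: single_closed_tensor simp flip: tensor_minus)

lemma ideal_tensor: "ideal (tensor_ideal M M') (monoid_algebra (M \<times>\<times> M'))"
  unfolding tensor_ideal_def by (rule F.genideal_ideal[OF bilinearity_relators_closed])

lemma assoc_algebra_tensor: "assoc_algebra (tensor_algebra M M')"
  unfolding tensor_algebra_def by (rule F.assoc_algebra_quotient[OF ideal_tensor])

lemmas tensor_hom = F.quotient_hom[OF ideal_tensor, folded tensor_algebra_def]

lemma tensor_ring_hom:
  "(+>\<^bsub>monoid_algebra (M \<times>\<times> M')\<^esub>) (tensor_ideal M M')
    \<in> ring_hom (monoid_algebra (M \<times>\<times> M')) (tensor_algebra M M')"
  using tensor_hom by (simp add: algebra_hom_def)

lemma tensor_relator_eq:
  assumes "g - f \<in> bilinearity_relators M M'" "f \<in> carrier (monoid_algebra (M \<times>\<times> M'))"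
  shows "tensor_ideal M M' +>\<^bsub>monoid_algebra (M \<times>\<times> M')\<^esub> g =
    tensor_ideal M M' +>\<^bsub>monoid_algebra (M \<times>\<times> M')\<^esub> f"
proof -
  interpret T: assoc_algebra "tensor_algebra M M'" by (rule assoc_algebra_tensor)
  let ?\<pi> = "\<lambda>f. tensor_ideal M M' +>\<^bsub>monoid_algebra (M \<times>\<times> M')\<^esub> f"
  have r: "g - f \<in> carrier (monoid_algebra (M \<times>\<times> M'))"
    using assms(1) bilinearity_relators_closed by blast
  have "?\<pi> g = ?\<pi> (g - f) \<oplus>\<^bsub>tensor_algebra M M'\<^esub> ?\<pi> f"
    using ring_hom_add[OF tensor_ring_hom r assms(2)] by (simp add: monoid_algebra_simps(4))
  also have "?\<pi> (g - f) = \<zero>\<^bsub>tensor_algebra M M'\<^esub>"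
    unfolding tensor_algebra_def
    using assms(1) F.genideal_self[OF bilinearity_relators_closed]
    by (intro F.quotient_eq_zero ideal_tensor) (auto simp: tensor_ideal_def)
  finally show ?thesis
    using ring_hom_closed[OF tensor_ring_hom assms(2)] by simp
qed

lemma pure_tensor_closed:
  assumes "a \<in> carrier M" "b \<in> carrier M'"
  shows "pure_tensor M M' a b \<in> carrier (tensor_algebra M M')"
  unfolding pure_tensor_def
  by (rule ring_hom_closed[OF tensor_ring_hom single_closed_tensor[OF assms]])

lemma pure_tensor_mult:
  assumes "a \<in> carrier M" "b \<in> carrier M'" "a' \<in> carrier M" "b' \<in> carrier M'"
  shows "pure_tensor M M' a b \<otimes>\<^bsub>tensor_algebra M M'\<^esub> pure_tensor M M' a' b' =
    pure_tensor M M' (a \<otimes>\<^bsub>M\<^esub> a') (b \<otimes>\<^bsub>M'\<^esub> b')"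
  using ring_hom_mult[OF tensor_ring_hom single_closed_tensor[OF assms(1,2), of 1]
      single_closed_tensor[OF assms(3,4), of 1]]
  by (simp add: pure_tensor_def monoid_algebra_mult_single)

lemma pure_tensor_one:
  "pure_tensor M M' \<one>\<^bsub>M\<^esub> \<one>\<^bsub>M'\<^esub> = \<one>\<^bsub>tensor_algebra M M'\<^esub>"
  using ring_hom_one[OF tensor_ring_hom] by (simp add: pure_tensor_def monoid_algebra_simps)

lemma tensor_hom_single_add:
  assumes "a \<in> carrier M" "b \<in> carrier M'" "a' \<in> carrier M" "b' \<in> carrier M'"
  shows "tensor_ideal M M' +>\<^bsub>monoid_algebra (M \<times>\<times> M')\<^esub>
      (Poly_Mapping.single (a, b) 1 + Poly_Mapping.single (a', b') 1) =
    pure_tensor M M' a b \<oplus>\<^bsub>tensor_algebra M M'\<^esub> pure_tensor M M' a' b'"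
  using ring_hom_add[OF tensor_ring_hom single_closed_tensor[OF assms(1,2), of 1]
      single_closed_tensor[OF assms(3,4), of 1]]
  by (simp add: pure_tensor_def monoid_algebra_simps(4))

lemma tensor_hom_single:
  assumes "a \<in> carrier M" "b \<in> carrier M'"
  shows "tensor_ideal M M' +>\<^bsub>monoid_algebra (M \<times>\<times> M')\<^esub> Poly_Mapping.single (a, b) c =
    c \<odot>\<^bsub>tensor_algebra M M'\<^esub> pure_tensor M M' a b"
proof -
  have "Poly_Mapping.single (a, b) c =
      c \<odot>\<^bsub>monoid_algebra (M \<times>\<times> M')\<^esub> Poly_Mapping.single (a, b) 1"
    by (simp add: monoid_algebra_simps map_times_single)
  then show ?thesis
    using tensor_hom single_closed_tensor[OF assms, of 1]
    unfolding pure_tensor_def algebra_hom_def by simp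
qed

lemma pure_tensor_add_left:
  assumes "a \<in> carrier M" "a' \<in> carrier M" "b \<in> carrier M'"
  shows "pure_tensor M M' (a \<oplus>\<^bsub>M\<^esub> a') b =
    pure_tensor M M' a b \<oplus>\<^bsub>tensor_algebra M M'\<^esub> pure_tensor M M' a' b"
proof -
  let ?f = "Poly_Mapping.single (a, b) 1 + Poly_Mapping.single (a', b) (1 :: 'k)"
  have "Poly_Mapping.single (a \<oplus>\<^bsub>M\<^esub> a', b) 1 - ?f \<in> bilinearity_relators M M'"
    unfolding bilinearity_relators_def diff_diff_eq[symmetric] using assms by blast
  moreover have "?f \<in> carrier (monoid_algebra (M \<times>\<times> M'))"
    using F.a_closed[OF single_closed_tensor single_closed_tensor] assms
    by (simp add: monoid_algebra_simps(4))
  ultimately show ?thesis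
    unfolding pure_tensor_def tensor_hom_single_add[OF assms(1,3,2,3), unfolded pure_tensor_def, symmetric]
    by (rule tensor_relator_eq)
qed

lemma pure_tensor_add_right:
  assumes "a \<in> carrier M" "b \<in> carrier M'" "b' \<in> carrier M'"
  shows "pure_tensor M M' a (b \<oplus>\<^bsub>M'\<^esub> b') =
    pure_tensor M M' a b \<oplus>\<^bsub>tensor_algebra M M'\<^esub> pure_tensor M M' a b'"
proof -
  let ?f = "Poly_Mapping.single (a, b) 1 + Poly_Mapping.single (a, b') (1 :: 'k)"
  have "Poly_Mapping.single (a, b \<oplus>\<^bsub>M'\<^esub> b') 1 - ?f \<in> bilinearity_relators M M'"
    unfolding bilinearity_relators_def diff_diff_eq[symmetric] using assms by blast
  moreover have "?f \<in> carrier (monoid_algebra (M \<times>\<times> M'))"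
    using F.a_closed[OF single_closed_tensor single_closed_tensor] assms
    by (simp add: monoid_algebra_simps(4))
  ultimately show ?thesis
    unfolding pure_tensor_def tensor_hom_single_add[OF assms(1,2,1,3), unfolded pure_tensor_def, symmetric]
    by (rule tensor_relator_eq)
qed

lemma pure_tensor_smult_left:
  assumes "a \<in> carrier M" "b \<in> carrier M'"
  shows "pure_tensor M M' (c \<odot>\<^bsub>M\<^esub> a) b = c \<odot>\<^bsub>tensor_algebra M M'\<^esub> pure_tensor M M' a b"
proof -
  have "Poly_Mapping.single (c \<odot>\<^bsub>M\<^esub> a, b) 1 - Poly_Mapping.single (a, b) c \<in> bilinearity_relators M M'"
    unfolding bilinearity_relators_def using assms by blast
  then show ?thesis
    unfolding pure_tensor_def tensor_hom_single[OF assms, unfolded pure_tensor_def, symmetric]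
    by (rule tensor_relator_eq[OF _ single_closed_tensor[OF assms]])
qed

lemma pure_tensor_smult_right:
  assumes "a \<in> carrier M" "b \<in> carrier M'"
  shows "pure_tensor M M' a (c \<odot>\<^bsub>M'\<^esub> b) = c \<odot>\<^bsub>tensor_algebra M M'\<^esub> pure_tensor M M' a b"
proof -
  have "Poly_Mapping.single (a, c \<odot>\<^bsub>M'\<^esub> b) 1 - Poly_Mapping.single (a, b) c \<in> bilinearity_relators M M'"
    unfolding bilinearity_relators_def using assms by blast
  then show ?thesis
    unfolding pure_tensor_def tensor_hom_single[OF assms, unfolded pure_tensor_def, symmetric]
    by (rule tensor_relator_eq[OF _ single_closed_tensor[OF assms]])
qed

lemma tensor_hom_left:
  "(\<lambda>a. pure_tensor M M' a \<one>\<^bsub>M'\<^esub>) \<in> algebra_hom M (tensor_algebra M M')"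
  by (auto simp: algebra_hom_def ring_hom_def pure_tensor_closed pure_tensor_mult pure_tensor_one
      pure_tensor_add_left pure_tensor_smult_left)

lemma tensor_hom_right:
  "(\<lambda>b. pure_tensor M M' \<one>\<^bsub>M\<^esub> b) \<in> algebra_hom M' (tensor_algebra M M')"
  by (auto simp: algebra_hom_def ring_hom_def pure_tensor_closed pure_tensor_mult pure_tensor_one
      pure_tensor_add_right pure_tensor_smult_right)

text \<open>Both products are the pure tensor of \<open>a\<close> and \<open>b\<close>.\<close>

lemma tensor_commute:
  assumes "a \<in> carrier M" "b \<in> carrier M'"
  shows "pure_tensor M M' \<one>\<^bsub>M\<^esub> b \<otimes>\<^bsub>tensor_algebra M M'\<^esub> pure_tensor M M' a \<one>\<^bsub>M'\<^esub> =
    pure_tensor M M' a \<one>\<^bsub>M'\<^esub> \<otimes>\<^bsub>tensor_algebra M M'\<^esub> pure_tensor M M' \<one>\<^bsub>M\<^esub> b"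
  using assms by (simp add: pure_tensor_mult)

end

section \<open>The relations in the tensor product\<close>

lemma xp_relators_closed:
  "xp_relators N \<subseteq> carrier (free_algebra (xp_gens N) :: ('k::field, _) module)"
proof -
  interpret F: assoc_algebra "free_algebra (xp_gens N) :: ('k, _) module"
    by (rule assoc_algebra_free_algebra)
  have "free_gen (X i) \<in> carrier (free_algebra (xp_gens N) :: ('k, _) module)"
    "free_gen (P i) \<in> carrier (free_algebra (xp_gens N) :: ('k, _) module)" if "i \<in> {1..N}" for i
    using that by (auto intro!: free_gen_closed simp: xp_gens_def)
  then show ?thesis
    unfolding xp_relators_def Let_def commutator_def
    by (intro Un_least subsetI; elim CollectE exE conjE; hypsubst)
      (intro F.minus_closed F.a_closed F.m_closed F.smult_closed F.finsum_closed; blast)+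
qed

lemma clifford_relators_closed:
  "clifford_relators N \<epsilon> \<subseteq> carrier (free_algebra {1..N} :: ('k::field, _) module)"
proof -
  interpret F: assoc_algebra "free_algebra {1..N} :: ('k, _) module"
    by (rule assoc_algebra_free_algebra)
  have "free_gen i \<in> carrier (free_algebra {1..N} :: ('k, _) module)" if "i \<in> {1..N}" for i
    using that by (auto intro!: free_gen_closed)
  then show ?thesis
    unfolding clifford_relators_def Let_def
    by (intro subsetI; elim CollectE exE conjE; hypsubst)
      (intro F.minus_closed F.a_closed F.m_closed F.smult_closed F.one_closed; blast)+
qed

context
  fixes N :: nat and \<epsilon> :: int and T :: "('k::field_char_0, 'k \<A>\<C>) module"
  defines "T \<equiv> \<A>\<C> TYPE('k) N \<epsilon>"
begin

lemma assoc_algebra_\<A>: "assoc_algebra (\<A> N :: ('k, 'k \<A>) module)"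
  unfolding \<A>_def by (rule assoc_algebra_presented[OF xp_relators_closed])

lemma assoc_algebra_\<C>: "assoc_algebra (\<C> N \<epsilon> :: ('k, 'k \<C>) module)"
  unfolding \<C>_def by (rule assoc_algebra_presented[OF clifford_relators_closed])

lemma assoc_algebra_\<A>\<C>: "assoc_algebra T"
  unfolding T_def \<A>\<C>_def by (rule assoc_algebra_tensor[OF assoc_algebra_\<A> assoc_algebra_\<C>])

interpretation T: assoc_algebra T by (rule assoc_algebra_\<A>\<C>)

definition "ac_rep = ring_family_single T"
definition "ac_scalar c = ac_rep (c \<odot>\<^bsub>T\<^esub> \<one>\<^bsub>T\<^esub>)"

interpretation R: algebra_rep T ac_scalar ac_rep
  using T.algebra_rep_single unfolding ac_rep_def ac_scalar_def .

abbreviation "x i \<equiv> ac_rep (x_elem N \<epsilon> i)"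
abbreviation "p i \<equiv> ac_rep (p_elem N \<epsilon> i)"
abbreviation "e i \<equiv> ac_rep (e_elem N \<epsilon> i)"

lemma rep_\<A>: "algebra_rep (\<A> N) ac_scalar (\<lambda>a. ac_rep (pure_tensor (\<A> N) (\<C> N \<epsilon>) a \<one>\<^bsub>\<C> N \<epsilon>\<^esub>))"
  using R.algebra_rep_comp[OF assoc_algebra_\<A>] tensor_hom_left[OF assoc_algebra_\<A> assoc_algebra_\<C>]
  unfolding T_def \<A>\<C>_def comp_def by blast

lemma rep_\<C>: "algebra_rep (\<C> N \<epsilon>) ac_scalar (\<lambda>b. ac_rep (pure_tensor (\<A> N) (\<C> N \<epsilon>) \<one>\<^bsub>\<A> N\<^esub> b))"
  using R.algebra_rep_comp[OF assoc_algebra_\<C>] tensor_hom_right[OF assoc_algebra_\<A> assoc_algebra_\<C>]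
  unfolding T_def \<A>\<C>_def comp_def by blast

text \<open>The composite from the free algebra through \<open>\<A> N\<close> and the tensor product
  into the class ring; as a representation it evaluates each relator on the images of the
  generators.\<close>

definition "xp_rep f = ac_rep (pure_tensor (\<A> N) (\<C> N \<epsilon>)
  (Idl\<^bsub>free_algebra (xp_gens N)\<^esub> (xp_relators N) +>\<^bsub>free_algebra (xp_gens N)\<^esub> f) \<one>\<^bsub>\<C> N \<epsilon>\<^esub>)"

definition "e_rep f = ac_rep (pure_tensor (\<A> N) (\<C> N \<epsilon>) \<one>\<^bsub>\<A> N\<^esub>
  (Idl\<^bsub>free_algebra {1..N}\<^esub> (clifford_relators N \<epsilon>) +>\<^bsub>free_algebra {1..N}\<^esub> f))"

interpretation XP: algebra_rep "free_algebra (xp_gens N)" ac_scalar xp_rep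
  using algebra_rep.algebra_rep_comp[OF rep_\<A> assoc_algebra_free_algebra
      presented_hom[OF xp_relators_closed, of N, folded \<A>_def]]
  unfolding comp_def xp_rep_def .

interpretation E: algebra_rep "free_algebra {1..N}" ac_scalar e_rep
  using algebra_rep.algebra_rep_comp[OF rep_\<C> assoc_algebra_free_algebra
      presented_hom[OF clifford_relators_closed, of N \<epsilon>, folded \<C>_def]]
  unfolding comp_def e_rep_def .

lemma xp_rep_relator: "r \<in> xp_relators N \<Longrightarrow> xp_rep r = 0"
  using algebra_rep.rep_zero[OF rep_\<A>] presented_relator[OF xp_relators_closed, of r N]
  by (simp add: xp_rep_def \<A>_def)

lemma e_rep_relator: "r \<in> clifford_relators N \<epsilon> \<Longrightarrow> e_rep r = 0"
  using algebra_rep.rep_zero[OF rep_\<C>] presented_relator[OF clifford_relators_closed, of r N \<epsilon>]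
  by (simp add: e_rep_def \<C>_def)

section \<open>The relations between the images of the generators\<close>

lemma rep_gen:
  "xp_rep (free_gen (X i)) = x i" "xp_rep (free_gen (P i)) = p i" "e_rep (free_gen i) = e i"
  by (simp_all add: xp_rep_def e_rep_def x_elem_def p_elem_def e_elem_def presented_gen_def)

lemma gen_closed:
  assumes "i \<in> {1..N}"
  shows "free_gen (X i) \<in> carrier (free_algebra (xp_gens N))"
    "free_gen (P i) \<in> carrier (free_algebra (xp_gens N))"
    "free_gen i \<in> carrier (free_algebra {1..N})"
  using assms by (auto intro!: free_gen_closed simp: xp_gens_def)

lemma x_commute:
  assumes "i \<in> {1..N}" "j \<in> {1..N}"
  shows "x i * x j = x j * x i"
proof -
  have "commutator (free_algebra (xp_gens N)) (free_gen (X i)) (free_gen (X j)) \<in> (xp_relators N :: (_ \<Rightarrow>\<^sub>0 'k) set)"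
    unfolding xp_relators_def Let_def
    by (rule UnI1, rule UnI1, rule UnI1, rule CollectI, rule exI[of _ i], rule exI[of _ j],
        intro conjI refl assms)
  from xp_rep_relator[OF this] assms show ?thesis
    by (simp add: commutator_def XP.rep_minus XP.rep_mult gen_closed rep_gen)
qed

lemma p_commute:
  assumes "i \<in> {1..N}" "j \<in> {1..N}"
  shows "p i * p j = p j * p i"
proof -
  have "commutator (free_algebra (xp_gens N)) (free_gen (P i)) (free_gen (P j)) \<in> (xp_relators N :: (_ \<Rightarrow>\<^sub>0 'k) set)"
    unfolding xp_relators_def Let_def
    by (rule UnI1, rule UnI1, rule UnI2, rule CollectI, rule exI[of _ i], rule exI[of _ j],
        intro conjI refl assms)
  from xp_rep_relator[OF this] assms show ?thesis
    by (simp add: commutator_def XP.rep_minus XP.rep_mult gen_closed rep_gen)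
qed

lemma half_p2_x:
  assumes "j \<in> {1..N}"
  defines "H \<equiv> ac_scalar (1/2) * (\<Sum>i\<in>{1..N}. p i * p i)"
  shows "H * x j - x j * H = p j"
proof -
  let ?F = "free_algebra (xp_gens N) :: ('k, _) module"
  let ?H = "(1/2) \<odot>\<^bsub>?F\<^esub> (\<Oplus>\<^bsub>?F\<^esub>i\<in>{1..N}. free_gen (P i) \<otimes>\<^bsub>?F\<^esub> free_gen (P i))"
  have S: "(\<Oplus>\<^bsub>?F\<^esub>i\<in>{1..N}. free_gen (P i) \<otimes>\<^bsub>?F\<^esub> free_gen (P i)) \<in> carrier ?F"
    by (intro XP.finsum_closed Pi_I XP.m_closed gen_closed)
  have "xp_rep ?H = H"
    unfolding H_def XP.rep_smult[OF S] using XP.rep_finsum[of "\<lambda>i. free_gen (P i) \<otimes>\<^bsub>?F\<^esub> free_gen (P i)" "{1..N}"]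
    by (simp add: Pi_iff gen_closed XP.rep_mult rep_gen)
  moreover have "commutator ?F ?H (free_gen (X j)) \<ominus>\<^bsub>?F\<^esub> free_gen (P j) \<in> xp_relators N"
    unfolding xp_relators_def Let_def
    by (rule UnI1, rule UnI2, rule CollectI, rule exI[of _ j], rule conjI[OF refl assms(1)])
  ultimately show ?thesis
    using xp_rep_relator[of "commutator ?F ?H (free_gen (X j)) \<ominus>\<^bsub>?F\<^esub> free_gen (P j)"] XP.smult_closed[OF S] assms(1)
    by (simp add: commutator_def XP.rep_minus XP.rep_mult gen_closed rep_gen)
qed

lemma e_anticommute:
  assumes "i \<in> {1..N}" "j \<in> {1..N}"
  shows "e i * e j + e j * e i = ac_scalar (if i = j then 2 * of_int \<epsilon> else 0)"
proof -
  let ?F = "free_algebra {1..N} :: ('k, _) module"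
  have "(free_gen i \<otimes>\<^bsub>?F\<^esub> free_gen j \<oplus>\<^bsub>?F\<^esub> free_gen j \<otimes>\<^bsub>?F\<^esub> free_gen i)
      \<ominus>\<^bsub>?F\<^esub> (if i = j then 2 * of_int \<epsilon> else 0) \<odot>\<^bsub>?F\<^esub> \<one>\<^bsub>?F\<^esub> \<in> clifford_relators N \<epsilon>"
    unfolding clifford_relators_def Let_def
    by (rule CollectI, rule exI[of _ i], rule exI[of _ j], intro conjI refl assms)
  from e_rep_relator[OF this] assms show ?thesis
    by (simp add: E.rep_minus E.rep_add E.rep_mult E.rep_smult E.rep_one gen_closed rep_gen
        flip: E.sc_mult split del: if_split del: One_nat_def atLeastAtMost_iff)
qed

lemma presented_gen_closed:
  assumes "i \<in> {1..N}"
  shows "presented_gen (xp_gens N) (xp_relators N) (X i) \<in> carrier (\<A> N :: ('k, 'k \<A>) module)"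
    "presented_gen (xp_gens N) (xp_relators N) (P i) \<in> carrier (\<A> N :: ('k, 'k \<A>) module)"
    "presented_gen {1..N} (clifford_relators N \<epsilon>) i \<in> carrier (\<C> N \<epsilon> :: ('k, 'k \<C>) module)"
  unfolding presented_gen_def \<A>_def \<C>_def
  using presented_hom[OF xp_relators_closed, of N] presented_hom[OF clifford_relators_closed, of N \<epsilon>]
    gen_closed[OF assms]
  by (auto simp: algebra_hom_def ring_hom_def)

lemma ac_elem_closed:
  assumes "i \<in> {1..N}"
  shows "x_elem N \<epsilon> i \<in> carrier T" "p_elem N \<epsilon> i \<in> carrier T" "e_elem N \<epsilon> i \<in> carrier T"
  unfolding x_elem_def p_elem_def e_elem_def T_def \<A>\<C>_def
  by (intro pure_tensor_closed assoc_algebra_\<A> assoc_algebra_\<C> presented_gen_closed assms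
      assoc_algebra.axioms(1)[THEN ring.ring_simprules(6)])+

lemma e_x_commute:
  assumes "i \<in> {1..N}" "j \<in> {1..N}"
  shows "e i * x j = x j * e i"
proof -
  have "e_elem N \<epsilon> i \<otimes>\<^bsub>T\<^esub> x_elem N \<epsilon> j = x_elem N \<epsilon> j \<otimes>\<^bsub>T\<^esub> e_elem N \<epsilon> i"
    unfolding x_elem_def e_elem_def T_def \<A>\<C>_def
    by (rule tensor_commute[OF assoc_algebra_\<A> assoc_algebra_\<C>]) (rule presented_gen_closed assms)+
  then show ?thesis
    using ac_elem_closed assms by (simp flip: R.rep_mult)
qed

lemma e_p_commute:
  assumes "i \<in> {1..N}" "j \<in> {1..N}"
  shows "e i * p j = p j * e i"
proof -
  have "e_elem N \<epsilon> i \<otimes>\<^bsub>T\<^esub> p_elem N \<epsilon> j = p_elem N \<epsilon> j \<otimes>\<^bsub>T\<^esub> e_elem N \<epsilon> i"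
    unfolding p_elem_def e_elem_def T_def \<A>\<C>_def
    by (rule tensor_commute[OF assoc_algebra_\<A> assoc_algebra_\<C>]) (rule presented_gen_closed assms)+
  then show ?thesis
    using ac_elem_closed assms by (simp flip: R.rep_mult)
qed

lemma e_anticommute_distinct:
  assumes "i \<in> {1..N}" "j \<in> {1..N}" "i \<noteq> j"
  shows "e i * e j = - (e j * e i)"
proof -
  have "ac_scalar 0 = 0" using R.sc_add[of 0 0] by simp
  then have "e i * e j + e j * e i = 0"
    using e_anticommute[OF assms(1,2)] assms(3) by simp
  then show ?thesis by (simp only: eq_neg_iff_add_eq_0)
qed

lemma scalar_one:
  assumes "i \<in> {1..N}"
  shows "ac_scalar 1 * x i = x i" "ac_scalar 1 * p i = p i" "ac_scalar 1 * e i = e i"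
    "e i * ac_scalar 1 = e i"
  using R.rep_sc_one ac_elem_closed[OF assms] by simp_all

lemma scalar_half: "ac_scalar (1/2) + ac_scalar (1/2) = ac_scalar 1"
  by (simp flip: R.sc_add)

text \<open>The Clifford relator with \<open>i = j\<close> gives only twice the square; it is halved
  by \<open>ac_scalar (1/2)\<close>.\<close>

lemma e_square:
  assumes "i \<in> {1..N}"
  shows "e i * e i = ac_scalar (of_int \<epsilon>)"
proof -
  have "e i * e i = ac_scalar (1/2) * (e i * e i + e i * e i)"
    by (simp only: distrib_left distrib_right[symmetric] mult.assoc[symmetric] scalar_half
        scalar_one(3)[OF assms])
  also have "\<dots> = ac_scalar (of_int \<epsilon>)"
    using e_anticommute[OF assms assms] by (simp flip: R.sc_mult)
  finally show ?thesis .
qed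

interpretation xp_clifford "{1..N}" x p e "ac_scalar (1/2) * (\<Sum>i\<in>{1..N}. p i * p i)"
  "ac_scalar (of_int \<epsilon>)" "ac_scalar 1"
proof
  have "(ac_scalar (1/2) + ac_scalar (1/2)) * (\<Sum>i\<in>{1..N}. p i * p i) = (\<Sum>i\<in>{1..N}. p i * p i)"
    unfolding scalar_half sum_distrib_left
    by (rule sum.cong[OF refl]) (simp add: scalar_one flip: mult.assoc del: One_nat_def atLeastAtMost_iff)
  then show "ac_scalar (1/2) * (\<Sum>i\<in>{1..N}. p i * p i) + ac_scalar (1/2) * (\<Sum>i\<in>{1..N}. p i * p i)
      = (\<Sum>i\<in>{1..N}. p i * p i)"
    by (simp only: distrib_right)
qed (fact x_commute p_commute half_p2_x e_x_commute e_p_commute e_anticommute_distinct e_square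
   R.sc_central scalar_one | rule finite_atLeastAtMost)+

section \<open>Clifford words and the images of the operators\<close>

lemma e_list_closed: "set L \<subseteq> {1..N} \<Longrightarrow> e_list N \<epsilon> L \<in> carrier T"
  by (induction L) (auto simp: e_list_def T_def[symmetric] intro!: T.m_closed ac_elem_closed)

lemma ac_rep_e_list_Cons:
  assumes "set (a # L) \<subseteq> {1..N}"
  shows "ac_rep (e_list N \<epsilon> (a # L)) = e a * ac_rep (e_list N \<epsilon> L)"
proof -
  have "e_list N \<epsilon> (a # L) = e_elem N \<epsilon> a \<otimes>\<^bsub>T\<^esub> e_list N \<epsilon> L"
    by (simp add: e_list_def T_def)
  then show ?thesis
    using R.rep_mult[OF ac_elem_closed(3) e_list_closed] assms by simp
qed

lemma ac_rep_e_list_Nil: "ac_rep (e_list N \<epsilon> []) = ac_scalar 1"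
  using R.rep_one by (simp add: e_list_def T_def)

text \<open>Each letter of \<open>L\<close> contributes -1, except \<open>i\<close> itself, which by
  distinctness occurs at most once.\<close>

lemma e_list_times_e:
  assumes "set L \<subseteq> {1..N}" "distinct L" "i \<in> {1..N}"
  shows "ac_rep (e_list N \<epsilon> L) * e i =
    ac_scalar ((if i \<in> set L then - 1 else 1) * (-1) ^ length L) * (e i * ac_rep (e_list N \<epsilon> L))"
  using assms
proof (induction L)
  case Nil
  then show ?case
    using scalar_one[of i] by (simp add: ac_rep_e_list_Nil)
next
  case (Cons a L)
  have a: "a \<in> {1..N}" and aL: "a \<notin> set L" using Cons.prems by auto
  define g where "g = ac_rep (e_list N \<epsilon> L)"
  define c :: 'k where "c = (if i \<in> set L then - 1 else 1) * (-1) ^ length L"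
  have IH: "g * e i = ac_scalar c * (e i * g)"
    using Cons by (simp add: g_def c_def)
  have g': "ac_rep (e_list N \<epsilon> (a # L)) = e a * g"
    using Cons.prems by (simp add: ac_rep_e_list_Cons g_def)
  have "e a * g * e i = e a * (ac_scalar c * (e i * g))"
    unfolding mult.assoc IH ..
  also have "\<dots> = ac_scalar c * (e a * (e i * g))"
    by (rule R.sc_left)
  also have "\<dots> = ac_scalar ((if i \<in> set (a # L) then - 1 else 1) * (-1) ^ length (a # L)) * (e i * (e a * g))"
  proof (cases "i = a")
    case True
    \<comment> \<open>The extra -1 for membership and the extra -1 for the longer list cancel, as
      \<open>a\<close> is not in \<open>L\<close>.\<close>
    then show ?thesis using aL by (simp add: c_def)
  next
    case False
    then have "a \<noteq> i" by simp
    from e_anticommute_distinct[OF a Cons.prems(3) this]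
    have "e a * (e i * g) = - (e i * (e a * g))"
      by (simp flip: mult.assoc)
    then show ?thesis using False by (simp add: c_def R.sc_minus)
  qed
  finally show ?case unfolding g' .
qed

lemma e_list_commute:
  assumes "set L \<subseteq> {1..N}" "i \<in> {1..N}"
  shows "ac_rep (e_list N \<epsilon> L) * x i = x i * ac_rep (e_list N \<epsilon> L)"
    "ac_rep (e_list N \<epsilon> L) * p i = p i * ac_rep (e_list N \<epsilon> L)"
proof -
  have "ac_rep (e_list N \<epsilon> L) * y = y * ac_rep (e_list N \<epsilon> L)"
    if "\<And>j. j \<in> {1..N} \<Longrightarrow> e j * y = y * e j" for y
    using assms(1)
  proof (induction L)
    case Nil
    show ?case by (simp only: ac_rep_e_list_Nil R.sc_central)
  next
    case (Cons a L)
    then have a: "a \<in> {1..N}" and IH: "ac_rep (e_list N \<epsilon> L) * y = y * ac_rep (e_list N \<epsilon> L)"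
      by auto
    show ?case
      unfolding ac_rep_e_list_Cons[OF Cons.prems] mult.assoc IH
      by (simp only: that[OF a] flip: mult.assoc)
  qed
  then show "ac_rep (e_list N \<epsilon> L) * x i = x i * ac_rep (e_list N \<epsilon> L)"
    "ac_rep (e_list N \<epsilon> L) * p i = p i * ac_rep (e_list N \<epsilon> L)"
    using e_x_commute e_p_commute assms(2) by blast+
qed

lemma D_elem_closed: "D_elem N \<epsilon> \<in> carrier T"
  unfolding D_elem_def T_def[symmetric]
  by (intro T.finsum_closed Pi_I T.m_closed ac_elem_closed)

lemma ac_rep_D_elem: "ac_rep (D_elem N \<epsilon>) = D"
  unfolding D_elem_def T_def[symmetric] D_def
  by (subst R.rep_finsum) (auto intro!: T.m_closed ac_elem_closed sum.cong R.rep_mult)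

lemma x_vec_closed: "S \<subseteq> {1..N} \<Longrightarrow> x_vec N \<epsilon> S \<in> carrier T"
  unfolding x_vec_def T_def[symmetric]
  by (intro T.finsum_closed Pi_I T.m_closed ac_elem_closed) auto

lemma ac_rep_x_vec: "S \<subseteq> {1..N} \<Longrightarrow> ac_rep (x_vec N \<epsilon> S) = (\<Sum>b\<in>S. x b * e b)"
  unfolding x_vec_def T_def[symmetric]
  by (subst R.rep_finsum) (auto intro!: T.m_closed ac_elem_closed sum.cong R.rep_mult)

lemma O_op_rep:
  assumes "index_set As \<subseteq> {1..N}" "e_lists N \<epsilon> As \<in> carrier T"
  defines "E \<equiv> ac_rep (e_lists N \<epsilon> As)" and "V \<equiv> (\<Sum>b\<in>index_set As. x b * e b)"
  shows "O_op N \<epsilon> As \<in> carrier T"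
    and "ac_rep (O_op N \<epsilon> As) = ac_scalar (1/2) * (D * V * E - E * V * D - ac_scalar (of_int \<epsilon>) * E)"
  using assms(2) x_vec_closed[OF assms(1)] D_elem_closed
  by (simp_all add: O_op_def Let_def T_def[symmetric] R.rep_smult R.rep_minus R.rep_mult
      ac_rep_D_elem ac_rep_x_vec[OF assms(1)] E_def V_def)

lemma supercommutator_rep:
  assumes "index_set As \<subseteq> {1..N}" "e_lists N \<epsilon> As \<in> carrier T"
    and "index_set Bs \<subseteq> {1..N}" "e_lists N \<epsilon> Bs \<in> carrier T"
  defines "k \<equiv> card (index_set As) * card (index_set Bs) - card (index_set As \<inter> index_set Bs)"
  shows "supercommutator N \<epsilon> As Bs \<in> carrier T"
    and "ac_rep (supercommutator N \<epsilon> As Bs) =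
      ac_rep (O_op N \<epsilon> As) * ac_rep (O_op N \<epsilon> Bs)
      - ac_scalar ((-1) ^ k) * (ac_rep (O_op N \<epsilon> Bs) * ac_rep (O_op N \<epsilon> As))"
  using O_op_rep(1)[OF assms(1,2)] O_op_rep(1)[OF assms(3,4)]
  by (simp_all add: supercommutator_def Let_def T_def[symmetric] R.rep_smult R.rep_minus R.rep_mult k_def)

lemma sum_supercommutator_eq_zero:
  assumes "distinct A" "set A \<subseteq> {1..N}"
  shows "(\<Oplus>\<^bsub>T\<^esub>a\<in>set A. supercommutator N \<epsilon> [[a]] [[a], A]) = \<zero>\<^bsub>T\<^esub>"
proof (cases "A = []")
  case True
  then show ?thesis by (simp add: T.finsum_empty)
next
  case False
  define g where "g = ac_rep (e_list N \<epsilon> A)"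
  define \<sigma> :: 'k where "\<sigma> = (-1) ^ (length A - 1)"
  \<comment> \<open>The subtraction in the exponent of \<open>\<sigma>\<close> truncates at length
    0, where this equation fails; hence the separate case of the empty list.\<close>
  have \<sigma>: "(-1) ^ length A = - \<sigma>"
    using False by (cases A) (auto simp: \<sigma>_def)
  have "\<sigma> * \<sigma> = 1"
    by (simp add: \<sigma>_def flip: power_mult_distrib)
  then have \<sigma>\<sigma>: "ac_scalar \<sigma> * (ac_scalar \<sigma> * g) = g"
    using R.rep_sc_one(1)[OF e_list_closed[OF assms(2)]]
    by (simp add: g_def flip: mult.assoc R.sc_mult)
  interpret xp_clifford_list "{1..N}" x p e "ac_scalar (1/2) * (\<Sum>i\<in>{1..N}. p i * p i)"
    "ac_scalar (of_int \<epsilon>)" "ac_scalar 1" "set A" g "ac_scalar \<sigma>" "ac_scalar (1/2)"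
  proof
    show "g * e i = ac_scalar \<sigma> * (e i * g)" if "i \<in> set A" for i
      using e_list_times_e[OF assms(2,1), of i] that assms(2) \<sigma> by (auto simp: g_def)
    show "g * e i = - (ac_scalar \<sigma> * (e i * g))" if "i \<in> {1..N} - set A" for i
      using e_list_times_e[OF assms(2,1), of i] that \<sigma> by (auto simp: g_def R.sc_minus)
  qed (use assms(2) \<sigma>\<sigma> e_list_commute[OF assms(2)] in \<open>auto simp: R.sc_central g_def\<close>)
  have idx: "index_set [[a]] = {a}" "index_set [[a], A] = set A - {a}" if "a \<in> set A" for a
    using that by (auto simp: index_set_def)
  have E: "e_lists N \<epsilon> [[a]] = (e_elem N \<epsilon> a :: 'k \<A>\<C>)" "e_lists N \<epsilon> [[a], A] = e_elem N \<epsilon> a \<otimes>\<^bsub>T\<^esub> e_list N \<epsilon> A"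
    if "a \<in> set A" for a
    using that assms(2) ac_elem_closed(3)[of a] e_list_closed[OF assms(2)]
    by (auto simp: e_lists_def e_list_def[of N \<epsilon> "[a]"] T_def[symmetric])
  have closed: "supercommutator N \<epsilon> [[a]] [[a], A] \<in> carrier T"
    and rep: "ac_rep (supercommutator N \<epsilon> [[a]] [[a], A]) =
      ac_rep (O_op N \<epsilon> [[a]]) * ac_rep (O_op N \<epsilon> [[a], A])
      - ac_scalar \<sigma> * (ac_rep (O_op N \<epsilon> [[a], A]) * ac_rep (O_op N \<epsilon> [[a]]))"
    and O1: "ac_rep (O_op N \<epsilon> [[a]]) =
      ac_scalar (1/2) * (D * (x a * e a) * e a - e a * (x a * e a) * D - ac_scalar (of_int \<epsilon>) * e a)"
    and O2: "ac_rep (O_op N \<epsilon> [[a], A]) =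
      ac_scalar (1/2) * (D * (\<Sum>b\<in>set A - {a}. x b * e b) * (e a * g)
        - e a * g * (\<Sum>b\<in>set A - {a}. x b * e b) * D - ac_scalar (of_int \<epsilon>) * (e a * g))"
    if a: "a \<in> set A" for a
  proof -
    have aN: "a \<in> {1..N}" using a assms(2) by auto
    have I1: "index_set [[a]] \<subseteq> {1..N}" and I2: "index_set [[a], A] \<subseteq> {1..N}"
      using idx[OF a] aN assms(2) by auto
    have C1: "e_lists N \<epsilon> [[a]] \<in> carrier T" and C2: "e_lists N \<epsilon> [[a], A] \<in> carrier T"
      using E[OF a] ac_elem_closed(3)[OF aN] e_list_closed[OF assms(2)] by auto
    show "supercommutator N \<epsilon> [[a]] [[a], A] \<in> carrier T"
      by (rule supercommutator_rep(1)[OF I1 C1 I2 C2])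
    \<comment> \<open>As \<open>a\<close> lies in \<open>A\<close>, the index sets are
      \<open>{a}\<close> and \<open>set A - {a}\<close>, and their intersection is empty.\<close>
    have "card (index_set [[a]]) * card (index_set [[a], A]) - card (index_set [[a]] \<inter> index_set [[a], A])
        = length A - 1"
      using distinct_card[OF assms(1)] a by (simp add: idx[OF a])
    then show "ac_rep (supercommutator N \<epsilon> [[a]] [[a], A]) =
        ac_rep (O_op N \<epsilon> [[a]]) * ac_rep (O_op N \<epsilon> [[a], A])
        - ac_scalar \<sigma> * (ac_rep (O_op N \<epsilon> [[a], A]) * ac_rep (O_op N \<epsilon> [[a]]))"
      using supercommutator_rep(2)[OF I1 C1 I2 C2] by (simp only: \<sigma>_def)
    show "ac_rep (O_op N \<epsilon> [[a]]) =
      ac_scalar (1/2) * (D * (x a * e a) * e a - e a * (x a * e a) * D - ac_scalar (of_int \<epsilon>) * e a)"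
      using O_op_rep(2)[OF I1 C1] by (simp add: idx[OF a] E[OF a])
    show "ac_rep (O_op N \<epsilon> [[a], A]) =
      ac_scalar (1/2) * (D * (\<Sum>b\<in>set A - {a}. x b * e b) * (e a * g)
        - e a * g * (\<Sum>b\<in>set A - {a}. x b * e b) * D - ac_scalar (of_int \<epsilon>) * (e a * g))"
      using O_op_rep(2)[OF I2 C2] R.rep_mult[OF ac_elem_closed(3)[OF aN] e_list_closed[OF assms(2)]]
      by (simp add: idx[OF a] E[OF a] g_def)
  qed
  have "ac_rep (\<Oplus>\<^bsub>T\<^esub>a\<in>set A. supercommutator N \<epsilon> [[a]] [[a], A]) =
      (\<Sum>a\<in>set A. ac_rep (supercommutator N \<epsilon> [[a]] [[a], A]))"
    by (rule R.rep_finsum) (use closed in auto)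
  also have "\<dots> = 0"
    using sum_supercommutator by (simp add: rep O1 O2 cong: sum.cong)
  finally have "ac_rep (\<Oplus>\<^bsub>T\<^esub>a\<in>set A. supercommutator N \<epsilon> [[a]] [[a], A]) = ac_rep \<zero>\<^bsub>T\<^esub>"
    by (simp only: R.rep_zero)
  then show ?thesis
    unfolding ac_rep_def
    by (rule T.ring_family_single_inject[rotated 2]) (use closed in \<open>auto intro: T.finsum_closed\<close>)
qed

end

theorem theorem3p13:
  fixes N :: nat and \<epsilon> :: int and A :: "nat list"
  assumes "N \<ge> 1"
    and "\<epsilon> \<in> {1, -1}"
    and "distinct A"
    and "set A \<subseteq> {1..N}"
  shows "(\<Oplus>\<^bsub>\<A>\<C> TYPE(real) N \<epsilon>\<^esub>a\<in>set A. supercommutator N \<epsilon> [[a]] [[a], A])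
            = \<zero>\<^bsub>\<A>\<C> TYPE(real) N \<epsilon>\<^esub> \<and>
         (\<Oplus>\<^bsub>\<A>\<C> TYPE(complex) N \<epsilon>\<^esub>a\<in>set A. supercommutator N \<epsilon> [[a]] [[a], A])
            = \<zero>\<^bsub>\<A>\<C> TYPE(complex) N \<epsilon>\<^esub>"
  using assms(3,4) by (intro conjI sum_supercommutator_eq_zero)

end
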